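(* For real $q>0$ let $X_n=X_n(q)$ be the number of contacts of a friendly two-watermelon (without wall) of length $n$ under the Gibbs distribution with weight $q$. Then, as $n\to\infty$, with critical value $q_c=4/3$: for $0<q<4/3$, $X_n-1\xrightarrow{\mathcal{L}}\mathrm{NegBin}(2,1-\tfrac34 q)$; for $q=4/3$, $\frac{2}{3}\frac{X_n}{\sqrt n}\xrightarrow{\mathcal{L}}\mathcal{R}(\sqrt2)$; for $q>4/3$, $(X_n-\mu_n)/\sigma_n\xrightarrow{\mathcal{L}}\mathcal{N}(0,1)$, where $\mu_n$ and $\sigma_n^2$, the mean and variance of $X_n$, are both of order $n$.
   Context: A friendly two-watermelon (without wall) of length $n$ is a pair of directed walkers, each taking $n$ steps from $\{(1,1),(1,-1)\}$, starting at the same point and ending at the same point, which may meet and share edges but never cross. A contact is a point, other than the starting point, where both walkers occupy the same lattice point. Equivalently, the bivariate generating function of these objects by length ($z$) and number of contacts ($u$) is $F(z,u)=1/\big(1-u(z^2W(z)+2z)\big)$ with $W(z)=\frac{1-2z-\sqrt{1-4z}}{2z^2}$. Gibbs distribution: $\mathbb{P}(X_n(q)=k)=f_{n,k}q^k/\sum_j f_{n,j}q^j$, where $f_{n,k}$ is the number of objects of length $n$ with $k$ contacts. $\mathrm{NegBin}(r,p)$: $\mathbb{P}(X=k)=\binom{k+r-1}{k}p^r(1-p)^k$, $k\ge0$. $\mathcal{R}(\sigma)$: density $\frac{x}{\sigma^2}e^{-x^2/(2\sigma^2)}$, $x\ge0$. *)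

theory Defs
  imports "HOL-Probability.Probability" "HOL-Library.Landau_Symbols"
begin

definition steps :: "(int \<times> int) set" where
  "steps = {(1, 1), (1, -1)}"

text \<open>
  A walk is given by its list of steps; watermelons are counted up to translation, so the common
  starting point is taken to be the origin.
\<close>

definition position :: "(int \<times> int) list \<Rightarrow> nat \<Rightarrow> int \<times> int" where
  "position w i = sum_list (take i w)"

text \<open>
  The two walkers are listed as (upper, lower), so that each watermelon is counted once.
  Two walkers with a common start always have heights of equal parity at equal times, so they
  cannot pass each other without meeting; hence not crossing means that the first walker is weakly
  above the second one at all times.
\<close>

definition friendly_two_watermelons :: "nat \<Rightarrow> ((int \<times> int) list \<times> (int \<times> int) list) set" where
  "friendly_two_watermelons n =
     {(v, w). length v = n \<and> length w = n \<and> set v \<subseteq> steps \<and> set w \<subseteq> steps \<and>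
              position v n = position w n \<and>
              (\<forall>i\<le>n. snd (position w i) \<le> snd (position v i))}"

text \<open>
  The first coordinate of a position is the time, so common lattice points correspond to times at
  which the positions agree. The starting point is not counted, the end point is.
\<close>

definition contacts :: "(int \<times> int) list \<times> (int \<times> int) list \<Rightarrow> nat" where
  "contacts = (\<lambda>(v, w). card {i \<in> {1..length v}. position v i = position w i})"

definition num_watermelons :: "nat \<Rightarrow> nat \<Rightarrow> nat" where
  "num_watermelons n k = card {x \<in> friendly_two_watermelons n. contacts x = k}"

text \<open>
  The distribution of the number of contacts in the Gibbs model. There are at most \<open>n\<close> contacts,
  so the normalising sum is finite; lemma \<open>pmf_contacts_pmf\<close> shows that for \<open>q > 0\<close> the weights
  really do define a probability mass function.
\<close>

definition contacts_pmf :: "real \<Rightarrow> nat \<Rightarrow> nat pmf" where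
  "contacts_pmf q n =
     embed_pmf (\<lambda>k. real (num_watermelons n k) * q ^ k /
                    (\<Sum>j\<le>n. real (num_watermelons n j) * q ^ j))"

definition contacts_mean :: "real \<Rightarrow> nat \<Rightarrow> real" where
  "contacts_mean q n = measure_pmf.expectation (contacts_pmf q n) real"

definition contacts_variance :: "real \<Rightarrow> nat \<Rightarrow> real" where
  "contacts_variance q n = measure_pmf.variance (contacts_pmf q n) real"

definition rayleigh_density :: "real \<Rightarrow> real \<Rightarrow> real" where
  "rayleigh_density \<sigma> x = (if x \<ge> 0 then x / \<sigma>\<^sup>2 * exp (- x\<^sup>2 / (2 * \<sigma>\<^sup>2)) else 0)"

definition rayleigh_distribution :: "real \<Rightarrow> real measure" where
  "rayleigh_distribution \<sigma> = density lborel (\<lambda>x. ennreal (rayleigh_density \<sigma> x))"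


subsection \<open>Well-definedness of the Gibbs distribution\<close>

lemma finite_friendly_two_watermelons: "finite (friendly_two_watermelons n)"
proof (rule finite_subset)
  show "friendly_two_watermelons n \<subseteq>
          {v. set v \<subseteq> steps \<and> length v = n} \<times> {w. set w \<subseteq> steps \<and> length w = n}"
    by (auto simp: friendly_two_watermelons_def)
  have "finite {v. set v \<subseteq> steps \<and> length v = n}"
    by (rule finite_lists_length_eq) (simp add: steps_def)
  then show "finite ({v. set v \<subseteq> steps \<and> length v = n} \<times> {w. set w \<subseteq> steps \<and> length w = n})"
    by (intro finite_cartesian_product)
qed

lemma contacts_le:
  assumes "x \<in> friendly_two_watermelons n"
  shows "contacts x \<le> n"
proof -
  obtain v w where x: "x = (v, w)" "length v = n"
    using assms by (auto simp: friendly_two_watermelons_def)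
  have "contacts x \<le> card {1..length v}"
    unfolding contacts_def x prod.case by (rule card_mono) auto
  then show ?thesis using x by simp
qed

lemma num_watermelons_eq_0: "k > n \<Longrightarrow> num_watermelons n k = 0"
proof -
  assume "k > n"
  then have "{x \<in> friendly_two_watermelons n. contacts x = k} = {}"
    using contacts_le by (metis (mono_tags, lifting) Collect_empty_eq leD)
  then show ?thesis by (simp only: num_watermelons_def card.empty)
qed

lemma num_watermelons_diag_pos: "num_watermelons n n > 0"
proof -
  let ?v = "replicate n (1, 1) :: (int \<times> int) list"
  have "(?v, ?v) \<in> {x \<in> friendly_two_watermelons n. contacts x = n}"
  proof -
    have "?v \<in> {v. set v \<subseteq> steps \<and> length v = n}"
      by (auto simp: steps_def)
    moreover have "{i \<in> {1..n}. position ?v i = position ?v i} = {1..n}"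
      by blast
    ultimately show ?thesis
      by (simp add: friendly_two_watermelons_def contacts_def)
  qed
  moreover have "finite {x \<in> friendly_two_watermelons n. contacts x = n}"
    by (simp add: finite_friendly_two_watermelons)
  ultimately show ?thesis
    unfolding num_watermelons_def card_gt_0_iff by blast
qed

lemma pmf_contacts_pmf:
  assumes "q > 0"
  shows "pmf (contacts_pmf q n) k =
           real (num_watermelons n k) * q ^ k / (\<Sum>j\<le>n. real (num_watermelons n j) * q ^ j)"
proof -
  define Z where "Z = (\<Sum>j\<le>n. real (num_watermelons n j) * q ^ j)"
  define f where "f k = real (num_watermelons n k) * q ^ k / Z" for k
  have "0 < real (num_watermelons n n) * q ^ n"
    using assms num_watermelons_diag_pos by simp
  also have "\<dots> \<le> Z"
    unfolding Z_def using assms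
    by (intro member_le_sum[where f = "\<lambda>j. real (num_watermelons n j) * q ^ j"]) auto
  finally have Z: "Z > 0" .
  have nonneg: "f k \<ge> 0" for k
    using Z assms by (simp add: f_def)
  have "(\<integral>\<^sup>+k. f k \<partial>count_space UNIV) = (\<Sum>k\<le>n. ennreal (f k))"
    by (rule nn_integral_count_space') (auto simp: f_def num_watermelons_eq_0)
  also have "\<dots> = ennreal (\<Sum>k\<le>n. f k)"
    using nonneg by simp
  also have "(\<Sum>k\<le>n. f k) = 1"
    using Z by (simp add: f_def Z_def flip: sum_divide_distrib)
  finally have "pmf (embed_pmf f) k = f k"
    by (intro pmf_embed_pmf nonneg) simp
  then show ?thesis
    by (simp add: contacts_pmf_def f_def[abs_def] Z_def)
qed

end

theory Submission
  imports Defs "HOL-Complex_Analysis.Complex_Analysis"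
begin

text \<open>
  The difference of the two walkers is a Motzkin path with two kinds of level steps. The substitution
  \<open>z = y (1 - y)\<close> makes its generating function rational: the number of watermelons of length \<open>n\<close>
  with \<open>k\<close> contacts is the coefficient of \<open>z\<^sup>n\<close> in \<open>(y (2 - y))\<^sup>k\<close>. By Lagrange inversion and Cauchy's
  formula on \<open>\<bar>y\<bar> = 1/2\<close>, this number is \<open>4\<^sup>n (3/4)\<^sup>k * 2 k / (3 n)\<close> times a trigonometric integral,
  which Laplace's method shows to be asymptotic to \<open>exp (- k\<^sup>2 / (9 n)) / (2 sqrt (\<pi> n))\<close> for \<open>k\<close> of order
  at most \<open>sqrt n\<close>. For \<open>q < 4/3\<close>, dominated convergence yields the limits of all point probabilities.
  For \<open>q = 4/3\<close>, the rescaled point probabilities converge boundedly on compact sets to a Rayleigh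
  density. For \<open>q > 4/3\<close>, the pole of \<open>1 / (1 - u y (2 - y))\<close> moves inside \<open>\<bar>z\<bar> < 1/4\<close> and the moment
  generating function of \<open>X\<^sub>n\<close> is, up to an exponentially small error, \<open>A t * exp (n * \<Lambda> t)\<close> uniformly in
  a complex neighbourhood of \<open>0\<close>; this gives the mean, the variance and the central limit theorem.
\<close>

section \<open>Generating functions of watermelons\<close>

text \<open>The square root in W(z) is sqrt (1 - 4 z) = 1 - 2 y, which is why z = y (1 - y)
  rationalises F. Coefficients are read off as residues with dz = (1 - 2 y) dy; this is the formula
  in \<open>zcoeff\<close>, which makes sense for formal series, so no inverse function has to be
  constructed. The singularity z = 1/4 is y = 1/2, where y (2 - y) = 3/4; hence the critical value
  4/3. The prefactor k / n from Lagrange inversion explains two of the limit laws: k (3 q / 4)^k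
  normalises to a shifted NegBin(2, 1 - 3 q / 4), and at q = 4/3 it becomes the linear factor of the
  Rayleigh density. The main obstacle is uniformity in k: dominated convergence needs a Gaussian
  bound on the integrand for all 1 <= k <= n, not only for k of order sqrt n. At q = 4/3 the terms k
  (3 q / 4)^k are no longer summable, so the normalising constant gets an integral of its own. For q
  > 4/3 the pole is y = 1 - w with w = sqrt (1 - 1 / u); for real u > 1 it satisfies y < 1/2 exactly
  when u > 4/3.\<close>

text \<open>
  The difference of the heights starts at \<open>e\<close> instead of \<open>0\<close>, and the meetings counted by \<open>k\<close>
  include one at time \<open>0\<close>.
\<close>
definition pairs_from :: "nat \<Rightarrow> nat \<Rightarrow> int \<Rightarrow> ((int \<times> int) list \<times> (int \<times> int) list) set" where
  "pairs_from n k e =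
     {(v, w). length v = n \<and> length w = n \<and> set v \<subseteq> steps \<and> set w \<subseteq> steps \<and>
              (\<forall>i\<le>n. 0 \<le> e + snd (position v i) - snd (position w i)) \<and>
              e + snd (position v n) - snd (position w n) = 0 \<and>
              card {i \<in> {0..n}. e + snd (position v i) - snd (position w i) = 0} = k}"

lemma finite_pairs_from: "finite (pairs_from n k e)"
proof (rule finite_subset)
  show "pairs_from n k e \<subseteq>
          {v. set v \<subseteq> steps \<and> length v = n} \<times> {w. set w \<subseteq> steps \<and> length w = n}"
    by (auto simp: pairs_from_def)
  have "finite {v. set v \<subseteq> steps \<and> length v = n}"
    by (rule finite_lists_length_eq) (simp add: steps_def)
  then show "finite ({v. set v \<subseteq> steps \<and> length v = n} \<times> {w. set w \<subseteq> steps \<and> length w = n})"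
    by (intro finite_cartesian_product)
qed

lemma position_0 [simp]: "position v 0 = 0"
  by (simp add: position_def)

lemma position_Cons_Suc [simp]: "position (a # v) (Suc i) = a + position v i"
  by (simp add: position_def)

lemma fst_position:
  assumes "set v \<subseteq> steps" "i \<le> length v"
  shows   "fst (position v i) = int i"
  using assms
proof (induction v arbitrary: i)
  case (Cons a v)
  then show ?case by (cases i) (auto simp: steps_def)
qed (auto simp: position_def)

text \<open>Each step advances time by one, so at equal times the positions agree as soon as the
  heights do. The common start accounts for the extra contact in \<open>Suc k\<close>.\<close>

lemma num_watermelons_eq_pairs_from:
  "num_watermelons n k = card (pairs_from n (Suc k) 0)"
proof -
  have eq: "position v i = position w i \<longleftrightarrow> snd (position v i) - snd (position w i) = 0"
    if "set v \<subseteq> steps" "set w \<subseteq> steps" "length v = n" "length w = n" "i \<le> n" for v w i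
    using that fst_position[of v i] fst_position[of w i] by (auto simp: prod_eq_iff)
  have *: "card {i \<in> {0..n}. snd (position v i) - snd (position w i) = 0} =
             Suc (card {i \<in> {1..n}. position v i = position w i})"
    if "set v \<subseteq> steps" "set w \<subseteq> steps" "length v = n" "length w = n" for v w
  proof -
    have "{i \<in> {0..n}. snd (position v i) - snd (position w i) = 0} =
            insert 0 {i \<in> {1..n}. position v i = position w i}"
      using eq[OF that] by (auto simp: Suc_le_eq simp del: position_def)
    then show ?thesis by simp
  qed
  have "{x \<in> friendly_two_watermelons n. contacts x = k} = pairs_from n (Suc k) 0"
    unfolding friendly_two_watermelons_def pairs_from_def contacts_def
    using * eq[OF _ _ _ _ order_refl] by (auto split: prod.splits)
  then show ?thesis by (simp add: num_watermelons_def)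
qed

lemma pairs_from_neg: "e < 0 \<Longrightarrow> pairs_from n k e = {}"
  by (auto simp: pairs_from_def intro!: exI[of _ 0])

lemma pairs_from_0_contacts: "pairs_from n 0 e = {}"
proof -
  have "card {i \<in> {0..n}. e + snd (position v i) - snd (position w i) = 0} > 0"
    if "e + snd (position v n) - snd (position w n) = 0" for v w
    using that by (auto simp: card_gt_0_iff)
  then show ?thesis
    by (force simp: pairs_from_def simp del: card_gt_0_iff)
qed

lemma pairs_from_0: "pairs_from 0 k e = (if e = 0 \<and> k = 1 then {([], [])} else {})"
  by (auto simp: pairs_from_def conj_commute cong: conj_cong)

text \<open>Removing the first step of both walkers shifts the starting difference to
  \<open>e + snd a - snd b\<close>, and the removed time 0 was a meeting exactly when
  \<open>e = 0\<close>.\<close>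

lemma pairs_from_Suc:
  assumes "e \<ge> 0"
  shows "pairs_from (Suc n) k e =
           (\<Union>(a, b) \<in> steps \<times> steps. (\<lambda>(v, w). (a # v, b # w)) `
              {x. \<exists>j. k = (if e = 0 then Suc j else j) \<and> x \<in> pairs_from n j (e + snd a - snd b)})"
    (is "_ = ?R")
proof -
  have card: "card {i \<in> {0..Suc n}. e + snd (position (a # v) i) - snd (position (b # w) i) = 0} =
         (if e = 0 then Suc (card {i \<in> {0..n}. (e + snd a - snd b) + snd (position v i) - snd (position w i) = 0})
          else card {i \<in> {0..n}. (e + snd a - snd b) + snd (position v i) - snd (position w i) = 0})"
    for a b v w
  proof -
    let ?A = "{i \<in> {0..n}. (e + snd a - snd b) + snd (position v i) - snd (position w i) = 0}"
    have "{i \<in> {0..Suc n}. e + snd (position (a # v) i) - snd (position (b # w) i) = 0} =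
            (if e = 0 then insert 0 (Suc ` ?A) else Suc ` ?A)"
    proof (rule set_eqI)
      fix i show "(i \<in> {i \<in> {0..Suc n}. e + snd (position (a # v) i) - snd (position (b # w) i) = 0}) =
         (i \<in> (if e = 0 then insert 0 (Suc ` ?A) else Suc ` ?A))"
        by (cases i) (auto simp: algebra_simps)
    qed
    then show ?thesis by (simp add: card_image)
  qed
  have all: "(\<forall>i\<le>Suc n. 0 \<le> e + snd (position (a # v) i) - snd (position (b # w) i)) \<longleftrightarrow>
        (\<forall>i\<le>n. 0 \<le> (e + snd a - snd b) + snd (position v i) - snd (position w i))" for a b v w
    using assms by (simp add: less_Suc_eq_le[symmetric] All_less_Suc2 algebra_simps del: less_Suc_eq_le)
  have *: "(a # v, b # w) \<in> pairs_from (Suc n) k e \<longleftrightarrow>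
          a \<in> steps \<and> b \<in> steps \<and> (\<exists>j. k = (if e = 0 then Suc j else j) \<and> (v, w) \<in> pairs_from n j (e + snd a - snd b))"
    for a b v w
    unfolding pairs_from_def mem_Collect_eq prod.case card all by (auto simp: algebra_simps)
  show ?thesis
  proof (intro subset_antisym subsetI)
    fix x assume x: "x \<in> pairs_from (Suc n) k e"
    obtain a v b w where [simp]: "x = (a # v, b # w)"
      using x by (auto simp: pairs_from_def length_Suc_conv)
    show "x \<in> ?R"
      using x unfolding \<open>x = _\<close> * by force
  next
    fix x assume "x \<in> ?R"
    then show "x \<in> pairs_from (Suc n) k e"
      using * by fastforce
  qed
qed

text \<open>The four pairs of steps change the difference by 0, 0, 2 and -2: the recursion of
  Motzkin paths with two kinds of level steps. A negative new difference contributes the empty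
  set.\<close>

lemma card_pairs_from_Suc:
  assumes "e \<ge> 0"
  shows "card (pairs_from (Suc n) (Suc k) e) =
           (let j = (if e = 0 then k else Suc k) in
            2 * card (pairs_from n j e) + card (pairs_from n j (e + 2)) + card (pairs_from n j (e - 2)))"
proof -
  define j where "j = (if e = 0 then k else Suc k)"
  have "pairs_from (Suc n) (Suc k) e =
           (\<Union>(a, b) \<in> steps \<times> steps. (\<lambda>(v, w). (a # v, b # w)) ` pairs_from n j (e + snd a - snd b))"
    unfolding pairs_from_Suc[OF assms] j_def by (intro SUP_cong refl) auto
  also have "card \<dots> = (\<Sum>(a, b) \<in> steps \<times> steps.
       card ((\<lambda>(v, w). (a # v, b # w)) ` pairs_from n j (e + snd a - snd b)))"
    by (subst card_UN_disjoint) (auto simp: finite_pairs_from steps_def case_prod_unfold)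
  also have "\<dots> = (\<Sum>(a, b) \<in> steps \<times> steps. card (pairs_from n j (e + snd a - snd b)))"
    by (intro sum.cong refl) (auto intro!: card_image simp: inj_on_def)
  also have "\<dots> = 2 * card (pairs_from n j e) + card (pairs_from n j (e + 2)) + card (pairs_from n j (e - 2))"
    unfolding sum.cartesian_product[symmetric] by (simp add: steps_def add.commute)
  finally show ?thesis by (simp add: j_def Let_def)
qed

section \<open>Extracting coefficients in z from power series in y\<close>

text \<open>
  With \<open>z = y (1 - y)\<close>, this is the coefficient of \<open>z\<^sup>n\<close> in \<open>G\<close>, a power series in \<open>y\<close>.
\<close>
definition zcoeff :: "nat \<Rightarrow> complex fps \<Rightarrow> complex" where
  "zcoeff n G = fps_nth (G * (1 - 2 * fps_X) * inverse (1 - fps_X) ^ Suc n) n"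

lemma one_minus_X_inverse: "(1 - fps_X) * inverse (1 - fps_X :: complex fps) = 1"
  by (simp add: inverse_mult_eq_1')

lemma zcoeff_add: "zcoeff n (G + H) = zcoeff n G + zcoeff n H"
  by (simp add: zcoeff_def ring_distribs)

lemma zcoeff_diff: "zcoeff n (G - H) = zcoeff n G - zcoeff n H"
  by (simp add: zcoeff_def ring_distribs)

lemma zcoeff_const_mult: "zcoeff n (fps_const c * G) = c * zcoeff n G"
  by (simp add: zcoeff_def mult.assoc)

lemma zcoeff_sum: "zcoeff n (\<Sum>i\<in>A. G i) = (\<Sum>i\<in>A. zcoeff n (G i))"
  by (induction A rule: infinite_finite_induct) (simp_all add: zcoeff_add, simp_all add: zcoeff_def)

lemma zcoeff_0 [simp]: "zcoeff 0 G = fps_nth G 0"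
  by (simp add: zcoeff_def)

text \<open>Multiplication by z = y (1 - y) shifts the coefficients: the factor
  \<open>1 - fps_X\<close> cancels one inverse power and \<open>fps_X\<close> lowers the
  index.\<close>

lemma zcoeff_Suc: "zcoeff (Suc n) (fps_X * (1 - fps_X) * G) = zcoeff n G"
proof -
  have "fps_X * (1 - fps_X) * G * (1 - 2 * fps_X) * inverse (1 - fps_X) ^ Suc (Suc n) =
          fps_X * (((1 - fps_X) * inverse (1 - fps_X)) * (G * (1 - 2 * fps_X) * inverse (1 - fps_X) ^ Suc n))"
    by (simp add: algebra_simps)
  then show ?thesis
    by (simp only: zcoeff_def one_minus_X_inverse mult_1_left fps_X_mult_nth) simp
qed

text \<open>
  The coefficient of \<open>y\<^sup>n\<close> in \<open>y P' - n P\<close> vanishes; here \<open>P = G (1 - y)\<^sup>-\<^sup>n\<close>.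
\<close>
lemma zcoeff_eq_deriv:
  "of_nat n * zcoeff n G = fps_nth (fps_X * fps_deriv G * inverse (1 - fps_X) ^ n) n"
proof -
  define I where "I = inverse (1 - fps_X :: complex fps)"
  have I: "I - fps_X * I = 1"
    using one_minus_X_inverse unfolding I_def[symmetric] by (simp add: algebra_simps)
  have dI: "fps_deriv I = I\<^sup>2"
    unfolding I_def by (subst fps_inverse_deriv) auto
  define P where "P = G * I ^ n"
  have dP: "fps_deriv P = fps_deriv G * I ^ n + of_nat n * G * I ^ Suc n"
  proof (cases n)
    case 0
    then show ?thesis by (simp add: P_def)
  next
    case (Suc m)
    have "fps_deriv P = fps_deriv G * I ^ n + G * (of_nat n * I\<^sup>2 * I ^ m)"
      unfolding P_def Suc by (simp add: fps_deriv_power dI fps_of_nat algebra_simps del: power_Suc of_nat_Suc)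
    then show ?thesis by (simp add: Suc power2_eq_square algebra_simps)
  qed
  have "0 = fps_nth (fps_X * fps_deriv P - of_nat n * P) n"
    by (cases n) (simp_all flip: fps_of_nat)
  also have "fps_X * fps_deriv P - of_nat n * P =
               fps_X * fps_deriv G * I ^ n - of_nat n * (G * (I - fps_X * I - fps_X * I) * I ^ n)"
  proof -
    have "P = G * (I - fps_X * I) * I ^ n" by (simp add: P_def I)
    then have "of_nat n * P = of_nat n * (G * (I - fps_X * I) * I ^ n)" by simp
    then show ?thesis unfolding dP by (simp add: algebra_simps)
  qed
  also have "G * (I - fps_X * I - fps_X * I) * I ^ n = G * (1 - 2 * fps_X) * I ^ Suc n"
    by (simp add: algebra_simps)
  finally show ?thesis
    by (simp add: zcoeff_def I_def flip: fps_of_nat)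
qed

lemma zcoeff_1: "n > 0 \<Longrightarrow> zcoeff n 1 = 0"
  using zcoeff_eq_deriv[of n 1] by simp

text \<open>
  With \<open>C(z) = 1 / (1 - y)\<close> the Catalan series, \<open>ret_gf\<close> is \<open>z (1 + C) = z\<^sup>2 W(z) + 2 z\<close>, which
  enumerates the excursions between consecutive contacts, and \<open>desc_gf\<close> is \<open>C - 1\<close>, which
  enumerates the first passages one level down.
\<close>
definition ret_gf :: "complex fps" where
  "ret_gf = fps_X * (2 - fps_X)"

definition desc_gf :: "complex fps" where
  "desc_gf = fps_X * inverse (1 - fps_X)"

text \<open>First-step equation of an excursion: either both walkers share an edge (two ways), or
  they separate by one level and a first passage down follows.\<close>

lemma ret_gf_eq: "ret_gf = fps_X * (1 - fps_X) * (2 + desc_gf)"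
proof -
  have "fps_X * (1 - fps_X) * (2 + desc_gf) =
          fps_X * (2 * (1 - fps_X) + fps_X * ((1 - fps_X) * inverse (1 - fps_X)))"
    unfolding desc_gf_def by (simp add: algebra_simps)
  then show ?thesis
    unfolding one_minus_X_inverse by (simp add: ret_gf_def algebra_simps)
qed

text \<open>First-step equation of a first passage one level down: a step down, one of two level
  steps and then one passage, or a step up and then two passages. These terms add up to z (1 + 2 D +
  D^2) with D = \<open>desc_gf\<close>.\<close>

lemma desc_gf_eq: "desc_gf = fps_X * (1 - fps_X) * (1 + desc_gf)\<^sup>2"
proof -
  have e: "1 + desc_gf = inverse (1 - fps_X)"
    using one_minus_X_inverse by (simp add: desc_gf_def algebra_simps)
  have "fps_X * (1 - fps_X) * (inverse (1 - fps_X))\<^sup>2 =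
          fps_X * ((1 - fps_X) * inverse (1 - (fps_X :: complex fps))) * inverse (1 - fps_X)"
    by (simp add: power2_eq_square mult_ac)
  then show ?thesis
    unfolding e one_minus_X_inverse by (simp add: desc_gf_def)
qed

text \<open>A pair starting d levels apart makes d first passages down and then k excursions between
  its \<open>Suc k\<close> meetings, hence the product. The proof compares recursions: the equations
  for \<open>desc_gf\<close> and \<open>ret_gf\<close> are the first-step recursion for
  \<open>d > 0\<close> and \<open>d = 0\<close>.\<close>

lemma card_pairs_from:
  "of_nat (card (pairs_from n (Suc k) (2 * int d))) = zcoeff n (desc_gf ^ d * ret_gf ^ k)"
proof (induction n arbitrary: k d)
  case 0
  show ?case
    by (simp add: pairs_from_0 ret_gf_def desc_gf_def fps_nth_power_0)
next
  case (Suc n)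
  show ?case
  proof (cases d)
    case 0
    show ?thesis
    proof (cases k)
      case 0
      then show ?thesis
        using \<open>d = 0\<close> by (simp add: card_pairs_from_Suc pairs_from_0_contacts pairs_from_neg zcoeff_1)
    next
      case (Suc k')
      have "of_nat (card (pairs_from (Suc n) (Suc k) (2 * int d))) =
              zcoeff n (fps_const 2 * (desc_gf ^ 0 * ret_gf ^ k') + desc_gf ^ 1 * ret_gf ^ k')"
        using Suc.IH[of k' 0] Suc.IH[of k' 1] \<open>d = 0\<close> Suc unfolding zcoeff_add zcoeff_const_mult
        by (simp add: card_pairs_from_Suc pairs_from_neg)
      also have "fps_const 2 * (desc_gf ^ 0 * ret_gf ^ k') + desc_gf ^ 1 * ret_gf ^ k' =
                   (2 + desc_gf) * ret_gf ^ k'"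
        by (simp add: algebra_simps flip: numeral_fps_const)
      also have "zcoeff n \<dots> = zcoeff (Suc n) (ret_gf ^ k)"
        by (subst zcoeff_Suc[symmetric]) (simp add: Suc ret_gf_eq[symmetric] mult.assoc[symmetric])
      finally show ?thesis using \<open>d = 0\<close> by simp
    qed
  next
    case (Suc d')
    have e: "2 * int d + 2 = 2 * int (Suc d)" "2 * int d - 2 = 2 * int d'"
      using Suc by auto
    have "of_nat (card (pairs_from (Suc n) (Suc k) (2 * int d))) =
            zcoeff n (fps_const 2 * (desc_gf ^ d * ret_gf ^ k) + desc_gf ^ Suc d * ret_gf ^ k + desc_gf ^ d' * ret_gf ^ k)"
      unfolding zcoeff_add zcoeff_const_mult
      using Suc.IH[of k d] Suc.IH[of k "Suc d"] Suc.IH[of k d'] Suc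
      by (subst card_pairs_from_Suc) (simp_all only: e Let_def, simp_all)
    also have "fps_const 2 * (desc_gf ^ d * ret_gf ^ k) + desc_gf ^ Suc d * ret_gf ^ k + desc_gf ^ d' * ret_gf ^ k
                 = (1 + desc_gf)\<^sup>2 * desc_gf ^ d' * ret_gf ^ k"
      by (simp add: Suc power2_eq_square algebra_simps flip: numeral_fps_const)
    also have "zcoeff n \<dots> = zcoeff (Suc n) (desc_gf ^ d * ret_gf ^ k)"
      by (subst zcoeff_Suc[symmetric]) (simp add: Suc desc_gf_eq[symmetric] mult.assoc[symmetric])
    finally show ?thesis .
  qed
qed

lemma num_watermelons_zcoeff: "of_nat (num_watermelons n k) = zcoeff n (ret_gf ^ k)"
  using card_pairs_from[of n k 0] by (simp add: num_watermelons_eq_pairs_from)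

lemma num_watermelons_0_right: "n > 0 \<Longrightarrow> num_watermelons n 0 = 0"
  using num_watermelons_zcoeff[of n 0] by (simp add: zcoeff_1)

text \<open>Lagrange inversion: the derivative of (y (2 - y))^k is 2 k (1 - y) (y (2 - y))^(k - 1).
  Its factor 1 - y reduces the inverse power to n - 1, and the extracted y^k reduces the index to n
  - k.\<close>

lemma num_watermelons_coeff:
  assumes "1 \<le> k" "k \<le> n"
  shows "of_nat n * of_nat (num_watermelons n k) =
           2 * of_nat k * fps_nth ((2 - fps_X) ^ (k - 1) * inverse (1 - fps_X :: complex fps) ^ (n - 1)) (n - k)"
proof -
  define I where "I = inverse (1 - fps_X :: complex fps)"
  obtain j where k: "k = Suc j" using assms by (cases k) auto
  obtain m where n: "n = Suc m" using assms by (cases n) auto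
  have "of_nat n * of_nat (num_watermelons n k) = fps_nth (fps_X * fps_deriv (ret_gf ^ k) * I ^ n) n"
    by (simp add: num_watermelons_zcoeff zcoeff_eq_deriv I_def)
  also have "fps_deriv (ret_gf ^ k) = of_nat (2 * k) * (1 - fps_X) * ret_gf ^ j"
    unfolding of_nat_mult unfolding k by (simp add: fps_deriv_power ret_gf_def fps_of_nat algebra_simps del: power_Suc of_nat_Suc)
  also have "fps_X * (of_nat (2 * k) * (1 - fps_X) * ret_gf ^ j) * I ^ n =
               of_nat (2 * k) * (fps_X ^ k * ((2 - fps_X) ^ j * (((1 - fps_X) * I) * I ^ m)))"
    by (simp add: k n ret_gf_def power_mult_distrib mult_ac del: of_nat_Suc of_nat_mult)
  also have "(1 - fps_X) * I = 1"
    using one_minus_X_inverse by (simp add: I_def)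
  finally show ?thesis
    using assms by (simp add: I_def k n fps_X_power_mult_nth del: power_Suc flip: fps_of_nat)
qed

text \<open>A truncated geometric series, treated formally, so that it holds for every complex
  \<open>u\<close>, including those beyond the radius of convergence.\<close>

lemma watermelon_gf:
  "(\<Sum>k\<le>n. of_nat (num_watermelons n k) * u ^ k) = zcoeff n (inverse (1 - fps_const u * ret_gf))"
proof -
  define H where "H = fps_const u * ret_gf"
  have H: "(1 - H) * inverse (1 - H) = 1"
    by (rule inverse_mult_eq_1') (simp add: H_def ret_gf_def)
  have "(\<Sum>k\<le>n. of_nat (num_watermelons n k) * u ^ k) = zcoeff n (\<Sum>k\<le>n. H ^ k)"
    by (simp add: zcoeff_sum H_def power_mult_distrib zcoeff_const_mult fps_const_power
                  num_watermelons_zcoeff mult.commute[of "zcoeff n _"])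
  also have "(\<Sum>k\<le>n. H ^ k) = (\<Sum>k\<le>n. H ^ k) * ((1 - H) * inverse (1 - H))"
    by (simp add: H)
  also have "\<dots> = ((1 - H) * (\<Sum>k\<le>n. H ^ k)) * inverse (1 - H)"
    by (simp add: mult_ac)
  also have "(1 - H) * (\<Sum>k\<le>n. H ^ k) = 1 - H ^ Suc n"
    by (simp only: sum_gp_basic)
  also have "(1 - H ^ Suc n) * inverse (1 - H) = inverse (1 - H) - H ^ Suc n * inverse (1 - H)"
    by (simp add: algebra_simps)
  also have "zcoeff n \<dots> = zcoeff n (inverse (1 - H)) - zcoeff n (H ^ Suc n * inverse (1 - H))"
    by (rule zcoeff_diff)
  \<comment> \<open>The tail of the geometric series is divisible by y^(n+1) and cannot reach index
    n.\<close>
  also have "zcoeff n (H ^ Suc n * inverse (1 - H)) = 0"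
  proof -
    have "H ^ Suc n * inverse (1 - H) * (1 - 2 * fps_X) * inverse (1 - fps_X) ^ Suc n =
            fps_X ^ Suc n * ((fps_const u * (2 - fps_X)) ^ Suc n * inverse (1 - H) * (1 - 2 * fps_X) * inverse (1 - fps_X) ^ Suc n)"
      by (simp add: H_def ret_gf_def power_mult_distrib mult_ac del: power_Suc)
    then show ?thesis
      unfolding zcoeff_def by (simp only: fps_X_power_mult_nth) simp
  qed
  finally show ?thesis by (simp add: H_def)
qed

section \<open>Laplace's method on a circle\<close>

lemma divide_sqrt_tendsto_0: "(\<lambda>n. c / sqrt (real n)) \<longlonglongrightarrow> 0"
  by (intro tendsto_divide_0[OF tendsto_const] filterlim_at_top_imp_at_infinity
            filterlim_compose[OF sqrt_at_top filterlim_real_sequentially])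

text \<open>Cauchy's formula at radius 1/2, which is the source of the factor 2^n. The interval is
  centred at 0 so that the saddle point y = 1/2, at angle 0, lies in its interior.\<close>

lemma fps_nth_circle:
  assumes holo: "g holomorphic_on ball 0 1" and exp: "g has_fps_expansion G"
  shows "fps_nth G n = 2 ^ n / of_real (2 * pi) *
           (LINT \<theta>:{-pi..pi}|lborel. g (cis \<theta> / 2) * inverse (cis \<theta>) ^ n)"
proof -
  define f where "f = (\<lambda>\<theta>. g (cis \<theta> / 2) * inverse (cis \<theta>) ^ n)"
  have cont_g: "continuous_on (ball 0 1) g"
    using holo by (rule holomorphic_on_imp_continuous_on)
  have cont: "continuous_on A f" for A
    unfolding f_def by (intro continuous_intros continuous_on_compose2[OF cont_g]) (auto simp: norm_divide)
  have periodic: "f (x + 2 * pi) = f x" for x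
  proof -
    have "cis (x + 2 * pi) = cis x" by (simp add: cis_mult[symmetric])
    then show ?thesis by (simp only: f_def)
  qed
  have int: "f integrable_on {a..b}" for a b
    by (intro integrable_continuous_real cont)
  have "((\<lambda>u. g u / (u - 0) ^ Suc n) has_contour_integral (2 * pi * \<i>) / fact n * (deriv ^^ n) g 0) (circlepath 0 (1/2))"
  proof (rule Cauchy_has_contour_integral_higher_derivative_circlepath)
    show "continuous_on (cball 0 (1 / 2)) g"
      by (rule continuous_on_subset[OF cont_g]) auto
    show "g holomorphic_on ball 0 (1 / 2)"
      by (rule holomorphic_on_subset[OF holo]) auto
  qed auto
  then have "((\<lambda>\<theta>. g (cis \<theta> / 2) / (cis \<theta> / 2) ^ Suc n * (1/2) * \<i> * cis \<theta>) has_integral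
               (2 * pi * \<i>) * fps_nth G n) {0..2*pi}"
    unfolding circlepath_def fps_nth_fps_expansion[OF exp]
    by (subst (asm) has_contour_integral_part_circlepath_iff) simp_all
  moreover have "g (cis \<theta> / 2) / (cis \<theta> / 2) ^ Suc n * (1/2) * \<i> * cis \<theta> = 2 ^ n * \<i> * f \<theta>" for \<theta>
    by (simp add: f_def field_simps)
  ultimately have "((\<lambda>\<theta>. 2 ^ n * \<i> * f \<theta>) has_integral (2 * pi * \<i>) * fps_nth G n) {0..2*pi}"
    by simp
  then have "(2 * pi * \<i>) * fps_nth G n = integral {0..2*pi} (\<lambda>\<theta>. 2 ^ n * \<i> * f \<theta>)"
    by (rule integral_unique[symmetric])
  also have "\<dots> = 2 ^ n * \<i> * integral {0..2*pi} f"
    by simp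
  also have "integral {0..2*pi} f = integral {0..pi} f + integral {pi..2*pi} f"
    by (intro Henstock_Kurzweil_Integration.integral_combine[symmetric] int) auto
  \<comment> \<open>By periodicity the second half of the circle moves to negative angles.\<close>
  also have "integral {pi..2*pi} f = integral {-pi..0} f"
  proof -
    have "(f has_integral integral {pi..2*pi} f) {pi..2*pi}"
      using int by (rule integrable_integral)
    from has_integral_shift_real_ivl[OF this, of "2 * pi"] show ?thesis
      by (simp add: periodic integral_unique)
  qed
  also have "integral {0..pi} f + integral {-pi..0} f = integral {-pi..pi} f"
    by (subst add.commute, intro Henstock_Kurzweil_Integration.integral_combine int) auto
  also have "\<dots> = (LINT \<theta>:{-pi..pi}|lborel. f \<theta>)"
    by (intro set_borel_integral_eq_integral(2)[symmetric] borel_integrable_atLeastAtMost' cont)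
  finally show ?thesis
    by (simp add: f_def field_simps)
qed

lemma integrable_exp_square: "c > 0 \<Longrightarrow> integrable lborel (\<lambda>x. exp (- c * x\<^sup>2) :: real)"
proof -
  assume c: "c > 0"
  define \<sigma> where "\<sigma> = sqrt (1 / (2 * c))"
  have s: "\<sigma> > 0" "2 * \<sigma>\<^sup>2 = 1 / c" using c by (auto simp: \<sigma>_def)
  have "integrable lborel (\<lambda>x. sqrt (2 * pi * \<sigma>\<^sup>2) * normal_density 0 \<sigma> x)"
    using s by auto
  also have "(\<lambda>x. sqrt (2 * pi * \<sigma>\<^sup>2) * normal_density 0 \<sigma> x) = (\<lambda>x. exp (- c * x\<^sup>2))"
    using s by (auto simp: normal_density_def fun_eq_iff mult.commute)
  finally show ?thesis .
qed

text \<open>The substitution t = sqrt n * \<theta> makes the Gaussian integral independent of n.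
  Used for estimates uniform in the number of contacts.\<close>

lemma gaussian_bound_LINT:
  fixes \<phi> :: "real \<Rightarrow> complex"
  assumes c: "c > 0" and n: "n > 0"
    and bound: "\<And>\<theta>. \<bar>\<theta>\<bar> \<le> pi \<Longrightarrow> norm (\<phi> \<theta>) \<le> M * exp (- c * real n * \<theta>\<^sup>2)"
  shows "sqrt (real n) * norm (LINT \<theta>:{-pi..pi}|lborel. \<phi> \<theta>) \<le> M * (LINT t|lborel. exp (- c * t\<^sup>2))"
proof -
  have M: "M \<ge> 0" using order_trans[OF norm_ge_zero bound[of 0]] by simp
  have int: "integrable lborel (\<lambda>\<theta>. M * exp (- c * real n * \<theta>\<^sup>2))"
    using integrable_exp_square[of "c * real n"] c n by simp
  have "norm (LINT \<theta>:{-pi..pi}|lborel. \<phi> \<theta>) \<le> (LINT \<theta>|lborel. M * exp (- c * real n * \<theta>\<^sup>2))"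
    unfolding set_lebesgue_integral_def
    using bound M
    by (intro order_trans[OF integral_norm_bound] integral_mono'[OF int]) (auto simp: indicator_def abs_le_iff)
  also have "\<dots> = M * ((1 / sqrt n) * (LINT t|lborel. exp (- c * t\<^sup>2)))"
    using lborel_integral_real_affine[of "1 / sqrt n" "\<lambda>\<theta>. exp (- c * real n * \<theta>\<^sup>2)" 0] n
    by (simp add: power_divide)
  finally show ?thesis using n by (simp add: field_simps)
qed

text \<open>After the substitution t = sqrt n * \<theta> this is dominated convergence. The Gaussian
  bound holds on the whole interval, so central part and tails need not be separated.\<close>

lemma laplace_scaling:
  fixes \<phi> :: "nat \<Rightarrow> real \<Rightarrow> complex"
  assumes c: "c > 0"
    and cont: "\<And>n. continuous_on UNIV (\<phi> n)"
    and bound: "\<And>n \<theta>. n > 0 \<Longrightarrow> \<bar>\<theta>\<bar> \<le> pi \<Longrightarrow> norm (\<phi> n \<theta>) \<le> M * exp (- c * real n * \<theta>\<^sup>2)"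
    and lim: "\<And>t. (\<lambda>n. \<phi> n (t / sqrt n)) \<longlonglongrightarrow> \<Phi> t"
  shows "(\<lambda>n. complex_of_real (sqrt n) * (LINT \<theta>:{-pi..pi}|lborel. \<phi> n \<theta>)) \<longlonglongrightarrow> (LINT t|lborel. \<Phi> t)"
proof -
  define s where "s = (\<lambda>n t. indicator {-pi * sqrt n..pi * sqrt n} t *\<^sub>R \<phi> n (t / sqrt n))"
  have M: "M \<ge> 0" using order_trans[OF norm_ge_zero bound[of 1 0]] by simp
  have meas [measurable]: "\<phi> n \<in> borel_measurable borel" for n
    using cont by (rule borel_measurable_continuous_onI)
  have lim_s: "(\<lambda>n. s n t) \<longlonglongrightarrow> \<Phi> t" for t
  proof (rule Lim_transform_eventually[OF lim])
    have "eventually (\<lambda>n. \<bar>t\<bar> / pi \<le> sqrt (real n)) sequentially"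
      by (rule eventually_compose_filterlim[OF eventually_ge_at_top])
         (rule filterlim_compose[OF sqrt_at_top filterlim_real_sequentially])
    then show "eventually (\<lambda>n. \<phi> n (t / sqrt n) = s n t) sequentially"
      by eventually_elim (auto simp: s_def indicator_def field_simps abs_le_iff)
  qed
  \<comment> \<open>The index is shifted because the bound is available for positive n only.\<close>
  have 1: "(\<lambda>n. LINT t|lborel. s (Suc n) t) \<longlonglongrightarrow> (LINT t|lborel. \<Phi> t)"
  proof (rule integral_dominated_convergence[where w = "\<lambda>t. M * exp (- c * t\<^sup>2)"])
    show "\<Phi> \<in> borel_measurable lborel"
      by (rule borel_measurable_LIMSEQ_metric[OF _ lim_s]) (simp add: s_def)
    show "integrable lborel (\<lambda>t. M * exp (- c * t\<^sup>2))"
      using integrable_exp_square[OF c] by simp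
    show "AE t in lborel. (\<lambda>n. s (Suc n) t) \<longlonglongrightarrow> \<Phi> t"
      using LIMSEQ_Suc[OF lim_s] by simp
    show "AE t in lborel. norm (s (Suc n) t) \<le> M * exp (- c * t\<^sup>2)" for n
    proof (intro AE_I2)
      fix t :: real
      show "norm (s (Suc n) t) \<le> M * exp (- c * t\<^sup>2)"
      proof (cases "\<bar>t\<bar> \<le> pi * sqrt (Suc n)")
        case True
        then have "norm (\<phi> (Suc n) (t / sqrt (Suc n))) \<le> M * exp (- c * real (Suc n) * (t / sqrt (Suc n))\<^sup>2)"
          by (intro bound) (auto simp: field_simps simp del: of_nat_Suc)
        also have "\<dots> = M * exp (- c * t\<^sup>2)"
          by (simp add: power_divide)
        finally show ?thesis using True M by (auto simp: s_def indicator_def)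
      qed (use M in \<open>auto simp: s_def indicator_def abs_le_iff\<close>)
    qed
  qed (simp add: s_def)
  have "(LINT t|lborel. s (Suc n) t) =
          complex_of_real (sqrt (Suc n)) * (LINT \<theta>:{-pi..pi}|lborel. \<phi> (Suc n) \<theta>)" for n
  proof -
    have "(LINT t|lborel. s (Suc n) t) = sqrt (Suc n) *\<^sub>R (LINT \<theta>|lborel. s (Suc n) (0 + sqrt (Suc n) * \<theta>))"
      by (subst lborel_integral_real_affine[of "sqrt (Suc n)" _ 0]) (simp_all del: of_nat_Suc)
    also have "(\<lambda>\<theta>. s (Suc n) (0 + sqrt (Suc n) * \<theta>)) = (\<lambda>\<theta>. indicator {-pi..pi} \<theta> *\<^sub>R \<phi> (Suc n) \<theta>)"
    proof
      fix \<theta> :: real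
      define r where "r = sqrt (Suc n)"
      have r: "r > 0" by (simp add: r_def del: of_nat_Suc)
      have "- pi * r \<le> r * \<theta> \<longleftrightarrow> - pi \<le> \<theta>" "r * \<theta> \<le> pi * r \<longleftrightarrow> \<theta> \<le> pi"
        using mult_le_cancel_left_pos[OF r] by (metis mult.commute)+
      then show "s (Suc n) (0 + sqrt (Suc n) * \<theta>) = indicator {-pi..pi} \<theta> *\<^sub>R \<phi> (Suc n) \<theta>"
        using r by (simp add: s_def indicator_def r_def[symmetric] del: of_nat_Suc)
    qed
    finally show ?thesis
      by (simp add: set_lebesgue_integral_def scaleR_conv_of_real)
  qed
  then show ?thesis
    using 1 by (simp only:) (rule LIMSEQ_imp_Suc)
qed

text \<open>Rescaling by sqrt 2 turns the integral into the characteristic function of the standard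
  normal law at s / sqrt 2.\<close>

lemma gaussian_fourier_integral:
  "(LINT t|lborel. exp (\<i> * of_real (s * t) - of_real (t\<^sup>2))) = complex_of_real (sqrt pi * exp (- s\<^sup>2 / 4))"
proof -
  have "complex_of_real (exp (- (s / sqrt 2)\<^sup>2 / 2)) = char std_normal_distribution (s / sqrt 2)"
    by (simp add: char_std_normal_distribution)
  also have "\<dots> = (LINT x|lborel. std_normal_density x *\<^sub>R iexp ((s / sqrt 2) * x))"
    unfolding char_def by (subst integral_density) (auto simp: normal_density_nonneg)
  also have "\<dots> = sqrt 2 *\<^sub>R (LINT t|lborel. std_normal_density (0 + sqrt 2 * t) *\<^sub>R iexp ((s / sqrt 2) * (0 + sqrt 2 * t)))"
    by (subst lborel_integral_real_affine[of "sqrt 2" _ 0]) simp_all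
  also have "(\<lambda>t. std_normal_density (0 + sqrt 2 * t) *\<^sub>R iexp ((s / sqrt 2) * (0 + sqrt 2 * t))) =
               (\<lambda>t. complex_of_real (1 / sqrt (2 * pi)) * exp (\<i> * of_real (s * t) - of_real (t\<^sup>2)))"
    by (auto simp: std_normal_density_def fun_eq_iff scaleR_conv_of_real power_mult_distrib exp_diff exp_minus
               exp_of_real[symmetric] field_simps)
  finally have "complex_of_real (sqrt 2) * of_real (sqrt pi * exp (- s\<^sup>2 / 4)) =
          complex_of_real (sqrt 2) * (LINT t|lborel. exp (\<i> * of_real (s * t) - of_real (t\<^sup>2)))"
    by (simp add: scaleR_conv_of_real real_sqrt_mult power_divide field_simps)
  then show ?thesis
    by (subst (asm) mult_left_cancel) auto
qed

text \<open>The error in replacing \<open>ln (1 + x n)\<close> by \<open>x n\<close> is at most 2 |x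
  n|^2; multiplied by \<open>m n\<close> it is a bounded quantity times |x n|. Here \<open>m\<close>
  may stay bounded, which covers a fixed number of contacts.\<close>

lemma complex_power_tendsto_exp:
  fixes x :: "nat \<Rightarrow> complex" and m :: "nat \<Rightarrow> nat"
  assumes "x \<longlonglongrightarrow> 0" "(\<lambda>n. of_nat (m n) * x n) \<longlonglongrightarrow> A"
  shows "(\<lambda>n. (1 + x n) ^ m n) \<longlonglongrightarrow> exp A"
proof -
  have small: "eventually (\<lambda>n. norm (x n) < 1/2) sequentially"
    using order_tendstoD(2)[OF tendsto_norm[OF assms(1)], of "1/2"] by simp
  have "(\<lambda>n. of_nat (m n) * (ln (1 + x n) - x n)) \<longlonglongrightarrow> 0"
  proof (rule Lim_null_comparison)
    show "eventually (\<lambda>n. norm (of_nat (m n) * (ln (1 + x n) - x n)) \<le> 2 * norm (of_nat (m n) * x n) * norm (x n)) sequentially"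
      using small
    proof eventually_elim
      case (elim n)
      have "norm (ln (1 + x n) - x n) \<le> norm (x n) ^ 2 / (1 - norm (x n))"
        by (rule Ln_approx_linear) (use elim in auto)
      also have "\<dots> \<le> norm (x n) ^ 2 / (1 / 2)"
        using elim by (intro divide_left_mono) auto
      finally have "real (m n) * norm (ln (1 + x n) - x n) \<le> real (m n) * (2 * norm (x n) ^ 2)"
        by (intro mult_left_mono) auto
      then show ?case by (simp add: norm_mult power2_eq_square mult_ac)
    qed
    show "(\<lambda>n. 2 * norm (of_nat (m n) * x n) * norm (x n)) \<longlonglongrightarrow> 0"
      using tendsto_mult[OF tendsto_mult[OF tendsto_const[of 2] tendsto_norm[OF assms(2)]] tendsto_norm[OF assms(1)]]
      by simp
  qed
  from tendsto_add[OF this assms(2)]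
  have "(\<lambda>n. exp (of_nat (m n) * ln (1 + x n))) \<longlonglongrightarrow> exp A"
    by (intro tendsto_exp) (simp add: algebra_simps)
  moreover have "eventually (\<lambda>n. exp (of_nat (m n) * ln (1 + x n)) = (1 + x n) ^ m n) sequentially"
    using small
  proof eventually_elim
    case (elim n)
    then have "1 + x n \<noteq> 0" by (metis add_eq_0_iff2 norm_minus_cancel norm_one not_less_iff_gr_or_eq
       divide_less_eq_1 one_less_numeral_iff semiring_norm(76) zero_less_numeral)
    then show ?case by (simp add: exp_of_nat_mult)
  qed
  ultimately show ?thesis by (rule Lim_transform_eventually)
qed

section \<open>Gaussian domination and pointwise limit of the integrand\<close>

lemma cos_le_quartic: "cos x \<le> 1 - x\<^sup>2 / 2 + x ^ 4 / 24" for x :: real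
proof -
  obtain t where t: "cos x = (\<Sum>m<4. cos_coeff m * x ^ m) + cos (t + 1/2 * real 4 * pi) / fact 4 * x ^ 4"
    using Maclaurin_cos_expansion[of x 4] by blast
  have "cos (t + 1/2 * real 4 * pi) / fact 4 * x ^ 4 \<le> 1 / fact 4 * x ^ 4"
    by (intro mult_right_mono divide_right_mono cos_le_one) auto
  moreover have "(\<Sum>m<4. cos_coeff m * x ^ m) = 1 - x\<^sup>2 / 2"
  proof -
    have "(\<Sum>m<4. f m) = f 0 + f 1 + f 2 + f 3" for f :: "nat \<Rightarrow> real"
      by (simp add: eval_nat_numeral)
    then show ?thesis by (simp add: cos_coeff_def)
  qed
  ultimately show ?thesis
    using t by (simp add: fact_numeral)
qed

text \<open>The quartic bound is already negative at 8/5, so 8/5 lies beyond the first zero pi / 2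
  of the cosine.\<close>

lemma pi_less: "pi < 16/5"
proof (rule ccontr)
  assume *: "\<not> pi < 16/5"
  have "cos (8/5 :: real) < 0"
    using cos_le_quartic[of "8/5"] by (simp add: power_divide)
  moreover have "cos (8/5 :: real) \<ge> 0"
    using * by (intro cos_ge_zero) auto
  ultimately show False by simp
qed

text \<open>Any positive constant would do. With \<theta>^2 <= (16/5)^2 the quartic term is at most
  (32/75) \<theta>^2, which leaves 11/150 > 1/16 of the quadratic term 1/2.\<close>

lemma one_minus_cos_ge:
  assumes "\<bar>\<theta>\<bar> \<le> pi"
  shows "\<theta>\<^sup>2 / 16 \<le> 1 - cos \<theta>"
proof -
  have "\<theta>\<^sup>2 \<le> (16/5)\<^sup>2"
    using assms pi_less by (intro power2_le_iff_abs_le[THEN iffD2]) auto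
  then have "\<theta>\<^sup>2 * \<theta>\<^sup>2 \<le> (16/5)\<^sup>2 * \<theta>\<^sup>2"
    by (intro mult_right_mono) auto
  then have "\<theta> ^ 4 \<le> (256/25) * \<theta>\<^sup>2"
    by (simp add: power2_eq_square power4_eq_xxxx)
  then show ?thesis
    using cos_le_quartic[of \<theta>] zero_le_power2[of \<theta>] by linarith
qed

text \<open>
  On the circle \<open>\<bar>y\<bar> = 1/2\<close>, which passes through the saddle point \<open>y = 1/2\<close>, that is \<open>z = 1/4\<close>,
  the powers of \<open>y\<close> combine with those of \<open>1 - y\<close> into a function of
  \<open>cis \<theta> * (2 - cis \<theta>) = 1 - (cis \<theta> - 1)\<^sup>2\<close>.
\<close>
definition saddle_kernel :: "nat \<Rightarrow> nat \<Rightarrow> real \<Rightarrow> complex" where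
  "saddle_kernel n k \<theta> = (cis \<theta> * (4 - cis \<theta>) / 3) ^ (k - 1) * inverse (cis \<theta> * (2 - cis \<theta>)) ^ (n - 1)"

lemma two_minus_cis_nz: "2 - cis \<theta> \<noteq> 0" 
  by (metis eq_iff_diff_eq_0 norm_cis norm_numeral numeral_eq_one_iff semiring_norm(83))

lemma continuous_saddle_kernel: "continuous_on A (saddle_kernel n k)"
  unfolding saddle_kernel_def using two_minus_cis_nz by (intro continuous_intros) auto

text \<open>With v = 1 - cos \<theta> the two factors have squared moduli 1 + 8 v / 9 and 1 + 4 v.
  Since the first is at least 1 and k <= n, its exponent may be raised to n - 1, which makes the
  bound uniform in k. The quotient still decays because 8/9 < 4.\<close>

lemma norm_saddle_kernel_le:
  assumes "1 \<le> k" "k \<le> n" "\<bar>\<theta>\<bar> \<le> pi"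
  shows "norm (saddle_kernel n k \<theta>) \<le> exp 1 * exp (- (1/64) * real n * \<theta>\<^sup>2)"
proof (rule power2_le_imp_le)
  define v where "v = 1 - cos \<theta>"
  have v: "0 \<le> v" "v \<le> 2" "\<theta>\<^sup>2 / 16 \<le> v"
    using one_minus_cos_ge[OF assms(3)] cos_ge_minus_one[of \<theta>] by (auto simp: v_def)
  have sc: "sin \<theta> * sin \<theta> = 1 - cos \<theta> * cos \<theta>"
    using sin_squared_eq[of \<theta>] by (simp add: power2_eq_square)
  have a: "(norm (cis \<theta> * (4 - cis \<theta>) / 3))\<^sup>2 = 1 + 8 * v / 9"
    unfolding norm_divide norm_mult norm_cis power_divide mult_1_left cmod_power2
    by (simp add: v_def power2_eq_square algebra_simps sc diff_divide_distrib)
  have b: "(norm (cis \<theta> * (2 - cis \<theta>)))\<^sup>2 = 1 + 4 * v"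
    unfolding norm_mult norm_cis mult_1_left cmod_power2
    by (simp add: v_def power2_eq_square algebra_simps sc)
  \<comment> \<open>As v <= 2, the exponential bound gives exp (v / 2) <= 1 + v, and (1 + 8 v / 9)
    (1 + v) <= 1 + 4 v since 8 v^2 / 9 <= 16 v / 9.\<close>
  have ab: "(1 + 8 * v / 9) / (1 + 4 * v) \<le> exp (- v / 2)"
  proof -
    have "exp (v / 2) \<le> 1 + v / 2 + (v / 2)\<^sup>2"
      using v by (intro exp_bound) auto
    also have "\<dots> \<le> 1 + v"
      using mult_left_mono[OF v(2,1)] by (simp add: power2_eq_square)
    finally have "(1 + 8 * v / 9) * exp (v / 2) \<le> (1 + 8 * v / 9) * (1 + v)"
      using v by (intro mult_left_mono) auto
    also have "\<dots> \<le> 1 + 4 * v"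
      using mult_left_mono[OF v(2,1)] v(1) by (simp add: algebra_simps)
    finally show ?thesis
      using v by (simp add: exp_minus field_simps)
  qed
  have "(norm (saddle_kernel n k \<theta>))\<^sup>2 =
          ((norm (cis \<theta> * (4 - cis \<theta>) / 3))\<^sup>2) ^ (k - 1) / ((norm (cis \<theta> * (2 - cis \<theta>)))\<^sup>2) ^ (n - 1)"
    unfolding saddle_kernel_def norm_mult[of "_ ^ _"] norm_power norm_inverse power_mult_distrib divide_inverse[of "_ ^ (k - 1)"]
    by (simp only: power_inverse power_mult[symmetric] mult.commute[of 2])
  also have "\<dots> = (1 + 8 * v / 9) ^ (k - 1) / (1 + 4 * v) ^ (n - 1)"
    unfolding a b ..
  also have "\<dots> \<le> (1 + 8 * v / 9) ^ (n - 1) / (1 + 4 * v) ^ (n - 1)"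
    using v assms by (intro divide_right_mono power_increasing) auto
  also have "\<dots> \<le> exp (- v / 2) ^ (n - 1)"
    unfolding power_divide[symmetric] using v by (intro power_mono ab) auto
  also have "\<dots> \<le> exp (- \<theta>\<^sup>2 / 32) ^ (n - 1)"
    using v by (intro power_mono) auto
  also have "\<dots> = exp (\<theta>\<^sup>2 / 32 - real n * \<theta>\<^sup>2 / 32)"
    using assms by (simp add: of_nat_diff field_simps flip: exp_of_nat_mult)
  \<comment> \<open>The constant 2 generously pays for replacing n - 1 by n; after the square root
    it is the factor \<open>exp 1\<close>.\<close>
  also have "\<dots> \<le> exp (2 - real n * \<theta>\<^sup>2 / 32)"
  proof -
    have "\<theta>\<^sup>2 \<le> (16/5)\<^sup>2"
      using assms pi_less by (intro power2_le_iff_abs_le[THEN iffD2]) auto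
    then show ?thesis by (simp add: power2_eq_square)
  qed
  also have "\<dots> = (exp 1 * exp (- (1/64) * real n * \<theta>\<^sup>2))\<^sup>2"
    by (simp add: power2_eq_square flip: exp_add)
  finally show "(norm (saddle_kernel n k \<theta>))\<^sup>2 \<le> (exp 1 * exp (- (1/64) * real n * \<theta>\<^sup>2))\<^sup>2" .
qed simp

lemma tendsto_sqrt_mult_cis:
  "(\<lambda>n. complex_of_real (sqrt (real n)) * (cis (t / sqrt n) - 1)) \<longlonglongrightarrow> \<i> * t"
proof (cases "t = 0")
  case False
  have "((\<lambda>z. exp (\<i> * z)) has_field_derivative \<i>) (at 0)"
    by (auto intro!: derivative_eq_intros)
  then have "((\<lambda>z. (exp (\<i> * z) - 1) / z) \<longlongrightarrow> \<i>) (at 0)"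
    by (simp add: DERIV_def)
  moreover have "filterlim (\<lambda>n. complex_of_real (t / sqrt (real n))) (at 0) sequentially"
  proof (rule filterlim_atI)
    have "(\<lambda>n. t / sqrt (real n)) \<longlonglongrightarrow> 0"
      by (rule divide_sqrt_tendsto_0)
    then show "(\<lambda>n. complex_of_real (t / sqrt (real n))) \<longlonglongrightarrow> 0"
      by (metis of_real_0 tendsto_of_real)
    show "eventually (\<lambda>n. complex_of_real (t / sqrt (real n)) \<noteq> 0) sequentially"
      using eventually_gt_at_top[of 0] by eventually_elim (use False in auto)
  qed
  ultimately have "(\<lambda>n. (exp (\<i> * of_real (t / sqrt n)) - 1) / of_real (t / sqrt n)) \<longlonglongrightarrow> \<i>"
    by (rule filterlim_compose)
  then have "(\<lambda>n. (exp (\<i> * of_real (t / sqrt n)) - 1) / of_real (t / sqrt n) * of_real t) \<longlonglongrightarrow> \<i> * t"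
    by (intro tendsto_mult tendsto_const)
  moreover have "(exp (\<i> * of_real (t / sqrt n)) - 1) / of_real (t / sqrt n) * of_real t =
                   complex_of_real (sqrt (real n)) * (cis (t / sqrt n) - 1)" for n :: nat
    using False by (simp add: cis_conv_exp)
  ultimately show ?thesis by simp
qed simp

text \<open>With d = cis (t / sqrt n) - 1, the bases are 1 + d (2 - d) / 3 and 1 - d^2. The second
  has no linear term, this being the saddle point, so its power n - 1 sees n d^2 -> - t^2, while the
  first, with an exponent of order sqrt n, contributes the oscillation 2 x t / 3.\<close>

lemma saddle_kernel_tendsto:
  fixes k :: "nat \<Rightarrow> nat"
  assumes "\<And>n. n > 0 \<Longrightarrow> 1 \<le> k n" "(\<lambda>n. real (k n) / sqrt n) \<longlonglongrightarrow> x"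
  shows "(\<lambda>n. saddle_kernel n (k n) (t / sqrt n)) \<longlonglongrightarrow> exp (\<i> * of_real (2 / 3 * x * t) - of_real (t\<^sup>2))"
proof -
  define d where "d = (\<lambda>n::nat. cis (t / sqrt n) - 1)"
  have inv_sqrt: "(\<lambda>n. 1 / sqrt (real n)) \<longlonglongrightarrow> 0"
    by (rule divide_sqrt_tendsto_0)
  have sd: "(\<lambda>n. complex_of_real (sqrt (real n)) * d n) \<longlonglongrightarrow> \<i> * t"
    unfolding d_def by (rule tendsto_sqrt_mult_cis)
  have d: "d \<longlonglongrightarrow> 0"
  proof -
    have "(\<lambda>n. of_real (1 / sqrt n) * (complex_of_real (sqrt (real n)) * d n)) \<longlonglongrightarrow> of_real 0 * (\<i> * t)"
      by (intro tendsto_mult sd tendsto_of_real inv_sqrt)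
    then have "(\<lambda>n. of_real (1 / sqrt n) * (complex_of_real (sqrt (real n)) * d n)) \<longlonglongrightarrow> 0" by simp
    then show ?thesis
      by (rule Lim_transform_eventually)
         (use eventually_gt_at_top[of 0] in eventually_elim, simp)
  qed
  have k: "(\<lambda>n. (real (k n) - 1) / sqrt n) \<longlonglongrightarrow> x"
    using tendsto_diff[OF assms(2) inv_sqrt] by (simp add: diff_divide_distrib)
  have 1: "(\<lambda>n. (1 + d n * (2 - d n) / 3) ^ (k n - 1)) \<longlonglongrightarrow> exp (of_real x * (\<i> * t) * (2 - 0) / 3)"
  proof (rule complex_power_tendsto_exp)
    show "(\<lambda>n. d n * (2 - d n) / 3) \<longlonglongrightarrow> 0"
      using d by (auto intro!: tendsto_eq_intros)
    have "(\<lambda>n. of_real ((real (k n) - 1) / sqrt n) * (of_real (sqrt (real n)) * d n) * (2 - d n) / 3)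
            \<longlonglongrightarrow> of_real x * (\<i> * t) * (2 - 0) / 3"
      by (intro tendsto_intros k sd d) auto
    then show "(\<lambda>n. of_nat (k n - 1) * (d n * (2 - d n) / 3)) \<longlonglongrightarrow> of_real x * (\<i> * t) * (2 - 0) / 3"
      by (rule Lim_transform_eventually)
         (use eventually_gt_at_top[of 0] in eventually_elim, use assms(1) in \<open>simp add: of_nat_diff\<close>)
  qed
  have 2: "(\<lambda>n. (1 + - (d n)\<^sup>2) ^ (n - 1)) \<longlonglongrightarrow> exp (of_real (1 - 0\<^sup>2) * (- ((\<i> * t)\<^sup>2)))"
  proof (rule complex_power_tendsto_exp)
    show "(\<lambda>n. - (d n)\<^sup>2) \<longlonglongrightarrow> 0"
      using d by (auto intro!: tendsto_eq_intros)
    have "(\<lambda>n. of_real (1 - (1 / sqrt (real n))\<^sup>2) * (- ((of_real (sqrt (real n)) * d n)\<^sup>2)))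
            \<longlonglongrightarrow> of_real (1 - 0\<^sup>2) * (- ((\<i> * t)\<^sup>2))"
      by (intro tendsto_intros inv_sqrt sd)
    then show "(\<lambda>n. of_nat (n - 1) * - (d n)\<^sup>2) \<longlonglongrightarrow> of_real (1 - 0\<^sup>2) * (- ((\<i> * t)\<^sup>2))"
    proof (rule Lim_transform_eventually)
      show "eventually (\<lambda>n. of_real (1 - (1 / sqrt (real n))\<^sup>2) * (- ((of_real (sqrt (real n)) * d n)\<^sup>2)) =
               of_nat (n - 1) * - (d n)\<^sup>2) sequentially"
        using eventually_gt_at_top[of 0]
      proof eventually_elim
        case (elim n)
        have "complex_of_real (sqrt (real n)) ^ 2 = of_nat n"
          by (simp flip: of_real_power)
        then show ?case
          using elim by (simp add: power_mult_distrib power_divide of_nat_diff field_simps)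
      qed
    qed
  qed
  have "(\<lambda>n. (1 + d n * (2 - d n) / 3) ^ (k n - 1) * inverse ((1 + - (d n)\<^sup>2) ^ (n - 1)))
          \<longlonglongrightarrow> exp (of_real x * (\<i> * t) * (2 - 0) / 3) * inverse (exp (of_real (1 - 0\<^sup>2) * (- ((\<i> * t)\<^sup>2))))"
    by (intro tendsto_mult 1 2 tendsto_inverse) auto
  also have "(\<lambda>n. (1 + d n * (2 - d n) / 3) ^ (k n - 1) * inverse ((1 + - (d n)\<^sup>2) ^ (n - 1))) =
               (\<lambda>n. saddle_kernel n (k n) (t / sqrt n))"
  proof
    fix n
    have "1 + d n * (2 - d n) / 3 = cis (t / sqrt n) * (4 - cis (t / sqrt n)) / 3"
         "1 + - (d n)\<^sup>2 = cis (t / sqrt n) * (2 - cis (t / sqrt n))"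
      by (simp_all add: d_def power2_eq_square field_simps)
    then show "(1 + d n * (2 - d n) / 3) ^ (k n - 1) * inverse ((1 + - (d n)\<^sup>2) ^ (n - 1)) = saddle_kernel n (k n) (t / sqrt n)"
      by (simp only: saddle_kernel_def power_inverse)
  qed
  finally show ?thesis
    by (simp only: exp_minus[symmetric] exp_add[symmetric]) (simp add: power_mult_distrib mult_ac)
qed

section \<open>Uniform asymptotics of the number of watermelons\<close>

definition saddle_integral :: "nat \<Rightarrow> nat \<Rightarrow> complex" where
  "saddle_integral n k = (LINT \<theta>:{-pi..pi}|lborel. saddle_kernel n k \<theta>) / of_real (2 * pi)"

text \<open>The integral is real by the symmetry \<theta> -> - \<theta>; \<open>Re\<close> serves to
  state the identities over the reals.\<close>

definition saddle_coeff :: "nat \<Rightarrow> nat \<Rightarrow> real" where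
  "saddle_coeff n k = Re (saddle_integral n k)"

lemma Re_of_real_mult: "Re (of_real c * z) = c * Re z"
  by simp

text \<open>On y = cis \<theta> / 2 the constants are pulled out so that the kernel equals 1 at
  \<theta> = 0. The base 4 is the inverse of z = 1/4, and 3/4 is the value of y (2 - y) at the
  saddle point.\<close>

lemma num_watermelons_saddle:
  assumes "1 \<le> k" "k \<le> n"
  shows "real (num_watermelons n k) = 4 ^ n * (3/4) ^ k * (2 * real k / (3 * real n)) * saddle_coeff n k"
proof -
  obtain j where k: "k = Suc j" using assms by (cases k) auto
  obtain m where n: "n = Suc m" using assms by (cases n) auto
  have jm: "j \<le> m" using assms k n by simp
  define g where "g = (\<lambda>y::complex. (2 - y) ^ j * inverse (1 - y) ^ m)"
  have "fps_nth ((2 - fps_X) ^ j * inverse (1 - fps_X :: complex fps) ^ m) (m - j) =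
          2 ^ (m - j) / of_real (2 * pi) * (LINT \<theta>:{-pi..pi}|lborel. g (cis \<theta> / 2) * inverse (cis \<theta>) ^ (m - j))"
  proof (rule fps_nth_circle)
    show "g holomorphic_on ball 0 1"
      unfolding g_def by (auto intro!: holomorphic_intros)
    show "g has_fps_expansion (2 - fps_X) ^ j * inverse (1 - fps_X :: complex fps) ^ m"
      unfolding g_def by (auto intro!: fps_expansion_intros)
  qed
  also have "(\<lambda>\<theta>. g (cis \<theta> / 2) * inverse (cis \<theta>) ^ (m - j)) =
               (\<lambda>\<theta>. (2 ^ m * (3/2) ^ j) * saddle_kernel n k \<theta>)"
  proof
    fix \<theta> :: real
    define e where "e = cis \<theta>"
    have e: "e \<noteq> 0" "2 - e \<noteq> 0" using two_minus_cis_nz by (auto simp: e_def)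
    have "(2 - e / 2) ^ j = (3/2) ^ j * ((4 - e) / 3) ^ j"
      by (simp add: field_simps flip: power_mult_distrib)
    moreover have "inverse (1 - e / 2) ^ m = 2 ^ m * inverse (2 - e) ^ m"
      using e by (simp add: field_simps flip: power_mult_distrib)
    moreover have "inverse e ^ (m - j) = e ^ j * inverse e ^ m"
      using e jm by (simp add: field_simps flip: power_add)
    ultimately show "g (cis \<theta> / 2) * inverse (cis \<theta>) ^ (m - j) = (2 ^ m * (3/2) ^ j) * saddle_kernel n k \<theta>"
      unfolding saddle_kernel_def g_def e_def[symmetric] k n
      by (simp add: power_mult_distrib power_divide mult_ac)
  qed
  finally have coeff: "fps_nth ((2 - fps_X) ^ j * inverse (1 - fps_X :: complex fps) ^ m) (m - j) =
          2 ^ (m - j) * 2 ^ m * (3/2) ^ j * saddle_integral n k"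
    by (simp add: saddle_integral_def set_lebesgue_integral_def mult.assoc)
  have "2 ^ (m - j) * 2 ^ m * (3/2) ^ j = (4 ^ m * (3/4) ^ j :: real)"
    using jm by (simp add: power_diff power_divide field_simps flip: power_mult_distrib)
  then have pow: "2 ^ (m - j) * 2 ^ m * (3/2) ^ j = complex_of_real (4 ^ n * (3/4) ^ k / 3)"
    by (simp add: n k flip: of_real_eq_iff[where ?'a = complex])
  have "complex_of_real (real n * real (num_watermelons n k)) =
          of_real (2 * real k * (4 ^ n * (3/4) ^ k / 3)) * saddle_integral n k"
    using num_watermelons_coeff[OF assms] coeff unfolding pow by (simp add: k n)
  then have "Re (complex_of_real (real n * real (num_watermelons n k))) =
          Re (of_real (2 * real k * (4 ^ n * (3/4) ^ k / 3)) * saddle_integral n k)"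
    by (rule arg_cong)
  then have "real n * real (num_watermelons n k) = 2 * real k * (4 ^ n * (3/4) ^ k / 3) * saddle_coeff n k"
    unfolding Re_of_real_mult Re_complex_of_real saddle_coeff_def .
  then show ?thesis
    using assms by (simp add: field_simps)
qed

lemma saddle_coeff_bounded:
  obtains C where "\<And>n k. 1 \<le> k \<Longrightarrow> k \<le> n \<Longrightarrow> sqrt (real n) * \<bar>saddle_coeff n k\<bar> \<le> C"
proof
  fix n k :: nat assume nk: "1 \<le> k" "k \<le> n"
  have "sqrt (real n) * norm (LINT \<theta>:{-pi..pi}|lborel. saddle_kernel n k \<theta>) \<le>
          exp 1 * (LINT t|lborel. exp (- (1/64) * t\<^sup>2))"
    using nk by (intro gaussian_bound_LINT norm_saddle_kernel_le) auto
  then have "sqrt (real n) * norm (saddle_integral n k) \<le> exp 1 * (LINT t|lborel. exp (- (1/64) * t\<^sup>2)) / (2 * pi)"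
    by (simp add: saddle_integral_def norm_divide field_simps)
  moreover have "sqrt (real n) * \<bar>saddle_coeff n k\<bar> \<le> sqrt (real n) * norm (saddle_integral n k)"
    unfolding saddle_coeff_def by (intro mult_left_mono abs_Re_le_cmod) auto
  ultimately show "sqrt (real n) * \<bar>saddle_coeff n k\<bar> \<le> exp 1 * (LINT t|lborel. exp (- (1/64) * t\<^sup>2)) / (2 * pi)"
    by linarith
qed

lemma saddle_coeff_tendsto:
  fixes k :: "nat \<Rightarrow> nat"
  assumes ev: "eventually (\<lambda>n. 1 \<le> k n \<and> k n \<le> n) sequentially"
    and lim: "(\<lambda>n. real (k n) / sqrt n) \<longlonglongrightarrow> x"
  shows "(\<lambda>n. sqrt (real n) * saddle_coeff n (k n)) \<longlonglongrightarrow> exp (- x\<^sup>2 / 9) / (2 * sqrt pi)"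
proof -
  \<comment> \<open>The value 1 replaces the finitely many inadmissible \<open>k n\<close>, so that
    the Gaussian bound holds for every positive n.\<close>
  define k' where "k' n = (if 1 \<le> k n \<and> k n \<le> n then k n else 1)" for n
  have eq: "eventually (\<lambda>n. k n = k' n) sequentially"
    using ev by eventually_elim (simp add: k'_def)
  have lim': "(\<lambda>n. real (k' n) / sqrt n) \<longlonglongrightarrow> x"
    by (rule Lim_transform_eventually[OF lim]) (use eq in eventually_elim, simp)
  have "(\<lambda>n. complex_of_real (sqrt n) * (LINT \<theta>:{-pi..pi}|lborel. saddle_kernel n (k' n) \<theta>))
          \<longlonglongrightarrow> (LINT t|lborel. exp (\<i> * of_real (2 / 3 * x * t) - of_real (t\<^sup>2)))"
  proof (rule laplace_scaling[where c = "1/64" and M = "exp 1"])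
    have k': "1 \<le> k' n" "k' n \<le> n" if "n > 0" for n
      using that by (auto simp: k'_def)
    show "norm (saddle_kernel n (k' n) \<theta>) \<le> exp 1 * exp (- (1/64) * real n * \<theta>\<^sup>2)"
      if "n > 0" "\<bar>\<theta>\<bar> \<le> pi" for n \<theta>
      using that k' by (intro norm_saddle_kernel_le) auto
    show "(\<lambda>n. saddle_kernel n (k' n) (t / sqrt n)) \<longlonglongrightarrow>
            exp (\<i> * of_real (2 / 3 * x * t) - of_real (t\<^sup>2))" for t
      by (rule saddle_kernel_tendsto) (use k' lim' in auto)
  qed (auto intro: continuous_saddle_kernel)
  also have "(LINT t|lborel. exp (\<i> * of_real (2 / 3 * x * t) - of_real (t\<^sup>2))) =
               complex_of_real (sqrt pi * exp (- (2 / 3 * x)\<^sup>2 / 4))"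
    by (rule gaussian_fourier_integral)
  finally have "(\<lambda>n. Re (complex_of_real (sqrt n) * (LINT \<theta>:{-pi..pi}|lborel. saddle_kernel n (k' n) \<theta>) / of_real (2 * pi)))
     \<longlonglongrightarrow> Re (complex_of_real (sqrt pi * exp (- (2 / 3 * x)\<^sup>2 / 4)) / of_real (2 * pi))"
    by (intro tendsto_intros) auto
  also have "Re (complex_of_real (sqrt pi * exp (- (2 / 3 * x)\<^sup>2 / 4)) / of_real (2 * pi)) =
               sqrt pi * exp (- (2 / 3 * x)\<^sup>2 / 4) / (2 * pi)"
    by (simp only: of_real_divide[symmetric] Re_complex_of_real)
  also have "\<dots> = exp (- x\<^sup>2 / 9) / (2 * sqrt pi)"
    by (simp add: power_mult_distrib power_divide real_div_sqrt field_simps)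
  also have "(\<lambda>n. Re (complex_of_real (sqrt n) * (LINT \<theta>:{-pi..pi}|lborel. saddle_kernel n (k' n) \<theta>) / of_real (2 * pi)))
               = (\<lambda>n. sqrt n * saddle_coeff n (k' n))"
    by (simp add: saddle_coeff_def saddle_integral_def fun_eq_iff
             flip: times_divide_eq_right)
  finally show ?thesis
    by (rule Lim_transform_eventually) (use eq in eventually_elim, simp)
qed

section \<open>The normalising constant at the critical weight\<close>

definition watermelon_weight :: "real \<Rightarrow> nat \<Rightarrow> real" where
  "watermelon_weight q n = (\<Sum>j\<le>n. real (num_watermelons n j) * q ^ j)"

text \<open>
  At \<open>u = 4/3\<close> the denominator \<open>1 - u y (2 - y)\<close> equals \<open>(1 - 2 y) (1 - 2 y / 3)\<close>, so the factor
  \<open>1 - 2 y\<close> from the change of variables cancels.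
\<close>
lemma watermelon_weight_critical:
  "complex_of_real (watermelon_weight (4/3) n) = 4 ^ n / of_real (2 * pi) *
     (LINT \<theta>:{-pi..pi}|lborel. 6 * cis \<theta> / (3 - cis \<theta>) * saddle_kernel (n + 2) 1 \<theta>)"
proof -
  define g where "g = (\<lambda>y::complex. inverse (1 - 2/3 * y) * inverse (1 - y) ^ Suc n)"
  define A :: "complex fps" where "A = 1 - fps_const (2/3) * fps_X"
  have A: "A * inverse A = 1" by (rule inverse_mult_eq_1') (simp add: A_def)
  have B: "(1 - 2 * fps_X :: complex fps) * inverse (1 - 2 * fps_X) = 1" by (rule inverse_mult_eq_1') simp
  have "complex_of_real (watermelon_weight (4/3) n) = zcoeff n (inverse (1 - fps_const (4/3) * ret_gf))"
    unfolding watermelon_gf[symmetric] by (simp add: watermelon_weight_def)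
  also have "1 - fps_const (4/3) * ret_gf = A * (1 - 2 * fps_X)"
    unfolding A_def ret_gf_def numeral_fps_const
    by (simp add: algebra_simps fps_eq_iff)
  also have "zcoeff n (inverse (A * (1 - 2 * fps_X))) = fps_nth (inverse A * inverse (1 - fps_X) ^ Suc n) n"
  proof -
    have "inverse (A * (1 - 2 * fps_X)) * (1 - 2 * fps_X) = inverse A * ((1 - 2 * fps_X) * inverse (1 - 2 * fps_X))"
      by (simp add: fps_inverse_mult mult_ac)
    then show ?thesis unfolding zcoeff_def B by simp
  qed
  also have "\<dots> = 2 ^ n / of_real (2 * pi) * (LINT \<theta>:{-pi..pi}|lborel. g (cis \<theta> / 2) * inverse (cis \<theta>) ^ n)"
  proof (rule fps_nth_circle)
    have "1 - 2 / 3 * y \<noteq> 0" if "norm y < 1" for y :: complex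
    proof
      assume "1 - 2 / 3 * y = 0"
      then have "y = 3 / 2" by (simp add: field_simps)
      with that show False by (simp add: norm_divide)
    qed
    then show "g holomorphic_on ball 0 1"
      unfolding g_def by (intro holomorphic_intros) auto
    show "g has_fps_expansion inverse A * inverse (1 - fps_X) ^ Suc n"
      unfolding g_def A_def by (intro fps_expansion_intros) auto
  qed
  \<comment> \<open>The powers are y^(-n) and (1 - y)^(-n-1); one factor \<open>cis \<theta>\<close>
    equalises them at n + 1 = (n + 2) - 1. The second argument 1 makes the contact factor of the
    kernel trivial.\<close>
  also have "(\<lambda>\<theta>. g (cis \<theta> / 2) * inverse (cis \<theta>) ^ n) =
               (\<lambda>\<theta>. 2 ^ n * (6 * cis \<theta> / (3 - cis \<theta>) * saddle_kernel (n + 2) 1 \<theta>))"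
  proof
    fix \<theta> :: real
    define e where "e = cis \<theta>"
    have "e \<noteq> 3" using norm_cis[of \<theta>] by (auto simp: e_def simp del: norm_cis)
    then have e: "e \<noteq> 0" "2 - e \<noteq> 0" "3 - e \<noteq> 0" using two_minus_cis_nz by (auto simp: e_def)
    have "inverse (1 - e / 2) ^ Suc n = 2 ^ Suc n * inverse (2 - e) ^ Suc n"
      using e by (simp add: field_simps flip: power_mult_distrib)
    moreover have "inverse (1 - 2/3 * (e / 2)) = 3 / (3 - e)"
      using e by (simp add: field_simps)
    moreover have "inverse e ^ n = e * inverse e ^ Suc n"
      using e by simp
    ultimately show "g (cis \<theta> / 2) * inverse (cis \<theta>) ^ n =
        2 ^ n * (6 * cis \<theta> / (3 - cis \<theta>) * saddle_kernel (n + 2) 1 \<theta>)"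
      unfolding saddle_kernel_def g_def e_def[symmetric]
      using e by (simp add: power_mult_distrib mult_ac)
  qed
  also have "2 ^ n / of_real (2 * pi) * (LINT \<theta>:{-pi..pi}|lborel. 2 ^ n * (6 * cis \<theta> / (3 - cis \<theta>) * saddle_kernel (n + 2) 1 \<theta>)) =
     (2 ^ n * 2 ^ n) / of_real (2 * pi) * (LINT \<theta>:{-pi..pi}|lborel. 6 * cis \<theta> / (3 - cis \<theta>) * saddle_kernel (n + 2) 1 \<theta>)"
    unfolding set_integral_mult_right by (simp add: mult.assoc)
  also have "2 ^ n * 2 ^ n = (4 ^ n :: complex)"
    by (simp flip: power_mult_distrib)
  finally show ?thesis .
qed

text \<open>The prefactor 6 e / (3 - e), with e = cis \<theta>, has modulus at most 3 on the circle
  and tends to 3 at the saddle point. Passing from kernel index n to n + 2 adds a factor that tends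
  to 1, so the limit is 3 sqrt pi / (2 pi).\<close>

lemma watermelon_weight_critical_tendsto:
  "(\<lambda>n. sqrt (real n) * watermelon_weight (4/3) n / 4 ^ n) \<longlonglongrightarrow> 3 / (2 * sqrt pi)"
proof -
  define \<phi> where "\<phi> = (\<lambda>n \<theta>. 6 * cis \<theta> / (3 - cis \<theta>) * saddle_kernel (n + 2) 1 \<theta>)"
  have nz: "norm (3 - cis \<theta>) \<ge> 2" for \<theta>
    using norm_triangle_ineq2[of 3 "cis \<theta>"] by simp
  have nz': "3 - cis \<theta> \<noteq> 0" for \<theta>
    using nz[of \<theta>] by auto
  have inv_sqrt: "(\<lambda>n. t / sqrt (real n)) \<longlonglongrightarrow> 0" for t
    by (rule divide_sqrt_tendsto_0)
  have *: "(\<lambda>n. complex_of_real (sqrt n) * (LINT \<theta>:{-pi..pi}|lborel. \<phi> n \<theta>))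
          \<longlonglongrightarrow> (LINT t|lborel. 3 * exp (\<i> * of_real (0 * t) - of_real (t\<^sup>2)))"
  proof (rule laplace_scaling[where c = "1/64" and M = "3 * exp 1"])
    show "continuous_on UNIV (\<phi> n)" for n
      unfolding \<phi>_def using nz' by (intro continuous_intros continuous_saddle_kernel) auto
  next
    fix n :: nat and \<theta> :: real assume "n > 0" and \<theta>: "\<bar>\<theta>\<bar> \<le> pi"
    have "norm (6 * cis \<theta> / (3 - cis \<theta>)) \<le> 3"
      using divide_left_mono[OF nz[of \<theta>], of 6] nz[of \<theta>] nz'[of \<theta>] by (simp add: norm_mult norm_divide mult_pos_pos)
    moreover have "norm (saddle_kernel (n + 2) 1 \<theta>) \<le> exp 1 * exp (- (1/64) * real n * \<theta>\<^sup>2)"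
    proof (rule order_trans)
      show "norm (saddle_kernel (n + 2) 1 \<theta>) \<le> exp 1 * exp (- (1/64) * real (n + 2) * \<theta>\<^sup>2)"
        using \<theta> by (intro norm_saddle_kernel_le) auto
    qed (simp add: algebra_simps)
    ultimately have "norm (\<phi> n \<theta>) \<le> 3 * (exp 1 * exp (- (1/64) * real n * \<theta>\<^sup>2))"
      unfolding \<phi>_def norm_mult[of _ "saddle_kernel _ _ _"] by (intro mult_mono) auto
    then show "norm (\<phi> n \<theta>) \<le> 3 * exp 1 * exp (- (1/64) * real n * \<theta>\<^sup>2)"
      by simp
  next
    fix t :: real
    have cis1: "(\<lambda>n. cis (t / sqrt (real n))) \<longlonglongrightarrow> cis 0"
      unfolding cis_conv_exp by (intro tendsto_intros tendsto_of_real inv_sqrt)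
    have "(\<lambda>n. saddle_kernel n 1 (t / sqrt n)) \<longlonglongrightarrow> exp (\<i> * of_real (2 / 3 * 0 * t) - of_real (t\<^sup>2))"
      using inv_sqrt by (intro saddle_kernel_tendsto) auto
    then have "(\<lambda>n. 6 * cis (t / sqrt n) / (3 - cis (t / sqrt n)) *
                (saddle_kernel n 1 (t / sqrt n) * (inverse (cis (t / sqrt n) * (2 - cis (t / sqrt n))))\<^sup>2)) \<longlonglongrightarrow>
            6 * cis 0 / (3 - cis 0) * (exp (\<i> * of_real (2 / 3 * 0 * t) - of_real (t\<^sup>2)) * (inverse (cis 0 * (2 - cis 0)))\<^sup>2)"
      by (intro tendsto_intros cis1) auto
    then have "(\<lambda>n. 6 * cis (t / sqrt n) / (3 - cis (t / sqrt n)) *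
                (saddle_kernel n 1 (t / sqrt n) * (inverse (cis (t / sqrt n) * (2 - cis (t / sqrt n))))\<^sup>2)) \<longlonglongrightarrow>
            3 * exp (\<i> * of_real (0 * t) - of_real (t\<^sup>2))"
      by simp
    then show "(\<lambda>n. \<phi> n (t / sqrt n)) \<longlonglongrightarrow> 3 * exp (\<i> * of_real (0 * t) - of_real (t\<^sup>2))"
    proof (rule Lim_transform_eventually)
      show "eventually (\<lambda>n. 6 * cis (t / sqrt n) / (3 - cis (t / sqrt n)) *
                (saddle_kernel n 1 (t / sqrt n) * (inverse (cis (t / sqrt n) * (2 - cis (t / sqrt n))))\<^sup>2) = \<phi> n (t / sqrt n)) sequentially"
        using eventually_gt_at_top[of 0]
      proof eventually_elim
        case (elim n)
        then have "n + 2 - 1 = (n - 1) + 2" by simp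
        then show ?case by (simp only: \<phi>_def saddle_kernel_def power_add) simp
      qed
    qed
  qed simp
  also have "(LINT t|lborel. 3 * exp (\<i> * of_real (0 * t) - of_real (t\<^sup>2))) =
               3 * complex_of_real (sqrt pi * exp (- 0\<^sup>2 / 4))"
    unfolding gaussian_fourier_integral[symmetric] by simp
  finally have L: "(\<lambda>n. complex_of_real (sqrt n) * (LINT \<theta>:{-pi..pi}|lborel. \<phi> n \<theta>)) \<longlonglongrightarrow> 3 * complex_of_real (sqrt pi * exp (- 0\<^sup>2 / 4))" .
  have "(\<lambda>n. Re (complex_of_real (sqrt n) * (LINT \<theta>:{-pi..pi}|lborel. \<phi> n \<theta>) / of_real (2 * pi)))
     \<longlonglongrightarrow> Re (3 * complex_of_real (sqrt pi * exp (- 0\<^sup>2 / 4)) / of_real (2 * pi))"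
    by (intro tendsto_Re tendsto_divide[OF L tendsto_const]) auto
  moreover have "complex_of_real (sqrt n) * (LINT \<theta>:{-pi..pi}|lborel. \<phi> n \<theta>) / of_real (2 * pi) =
                  complex_of_real (sqrt (real n) * watermelon_weight (4/3) n / 4 ^ n)" for n :: nat
    unfolding of_real_mult of_real_divide watermelon_weight_critical \<phi>_def by simp
  moreover have "Re (3 * complex_of_real (sqrt pi * exp (- 0\<^sup>2 / 4)) / of_real (2 * pi)) = 3 / (2 * sqrt pi)"
    by (simp add: real_div_sqrt field_simps)
  ultimately show ?thesis by (simp only: Re_complex_of_real)
qed

section \<open>The subcritical and the critical regime\<close>

lemma pmf_contacts:
  "q > 0 \<Longrightarrow> pmf (contacts_pmf q n) k = real (num_watermelons n k) * q ^ k / watermelon_weight q n"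
  by (simp add: pmf_contacts_pmf watermelon_weight_def)

lemma watermelon_weight_pos:
  assumes "q > 0" shows "watermelon_weight q n > 0"
  unfolding watermelon_weight_def
  by (rule sum_pos2[of _ n]) (use assms num_watermelons_diag_pos[of n] in auto)

lemma cdf_distr_pmf: "cdf (distr (measure_pmf p) borel f) x = measure_pmf.prob p {k. f k \<le> x}"
  unfolding cdf_def by (subst measure_distr) (auto simp: vimage_def)

text \<open>For a fixed positive number of contacts the counts have order 4^n n^(-3/2); this is the
  inverse of that order.\<close>

definition scaled_weight :: "real \<Rightarrow> nat \<Rightarrow> nat \<Rightarrow> real" where
  "scaled_weight q k n = real n * sqrt (real n) / 4 ^ n * (real (num_watermelons n k) * q ^ k)"

lemma scaled_weight_eq:
  assumes "1 \<le> k" "k \<le> n"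
  shows "scaled_weight q k n = 2 / 3 * real k * (3/4 * q) ^ k * (sqrt (real n) * saddle_coeff n k)"
  unfolding scaled_weight_def num_watermelons_saddle[OF assms]
  using assms by (simp add: power_mult_distrib power_divide field_simps)

lemma scaled_weight_zero_contacts: "n > 0 \<Longrightarrow> scaled_weight q 0 n = 0"
  by (simp add: scaled_weight_def num_watermelons_0_right)

lemma scaled_weight_tendsto:
  "(\<lambda>n. scaled_weight q k n) \<longlonglongrightarrow> real k * (3/4 * q) ^ k / (3 * sqrt pi)"
proof (cases "k = 0")
  case True
  then show ?thesis
    by (auto intro!: tendsto_eventually eventually_mono[OF eventually_gt_at_top[of 0]] simp: scaled_weight_zero_contacts)
next
  case False
  have ev: "eventually (\<lambda>n. 1 \<le> k \<and> k \<le> n) sequentially"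
    using eventually_ge_at_top[of k] by eventually_elim (use False in auto)
  have "(\<lambda>n. real k / sqrt (real n)) \<longlonglongrightarrow> 0"
    by (rule divide_sqrt_tendsto_0)
  from saddle_coeff_tendsto[OF ev this]
  have "(\<lambda>n. 2 / 3 * real k * (3/4 * q) ^ k * (sqrt (real n) * saddle_coeff n k)) \<longlonglongrightarrow>
          2 / 3 * real k * (3/4 * q) ^ k * (exp (- 0\<^sup>2 / 9) / (2 * sqrt pi))"
    by (intro tendsto_mult_left)
  then show ?thesis
    by (rule Lim_transform_eventually[THEN tendsto_eq_rhs])
       (use ev in \<open>eventually_elim, simp add: scaled_weight_eq\<close>, simp)
qed

lemma suminf_scaled_weight:
  "(\<Sum>k. scaled_weight q k n) = real n * sqrt (real n) / 4 ^ n * watermelon_weight q n"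
  unfolding watermelon_weight_def sum_distrib_left scaled_weight_def
  by (subst suminf_finite[of "{..n}"]) (auto simp: num_watermelons_eq_0)

text \<open>Tannery's theorem, with the uniform bound on \<open>saddle_coeff\<close> providing the
  majorant k r^k, summable because r = 3 q / 4 < 1. The limits sum to r / (1 - r)^2 up to the
  constant 1 / (3 sqrt pi), which cancels in the probabilities.\<close>

lemma subcritical_weight_tendsto:
  assumes q: "0 < q" "q < 4/3"
  shows "(\<lambda>n. real n * sqrt (real n) / 4 ^ n * watermelon_weight q n) \<longlonglongrightarrow>
           (3/4 * q) / (1 - 3/4 * q)\<^sup>2 / (3 * sqrt pi)"
proof -
  define r where "r = 3/4 * q"
  have r: "0 < r" "r < 1" using q by (auto simp: r_def)
  obtain C where C: "\<And>n k. 1 \<le> k \<Longrightarrow> k \<le> n \<Longrightarrow> sqrt (real n) * \<bar>saddle_coeff n k\<bar> \<le> C"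
    using saddle_coeff_bounded by blast
  have C0: "C \<ge> 0" using order_trans[OF _ C[of 1 1]] by simp
  have sums: "(\<lambda>k. real k * r ^ k) sums (r / (1 - r)\<^sup>2)"
  proof -
    have "(\<lambda>k. r * (real (Suc k) * r ^ k)) sums (r * (1 / (1 - r)\<^sup>2))"
      by (intro sums_mult geometric_deriv_sums) (use r in auto)
    then have "(\<lambda>k. real (Suc k) * r ^ Suc k) sums (r / (1 - r)\<^sup>2)"
      by (simp add: mult_ac)
    then show ?thesis by (subst (asm) sums_Suc_iff) simp
  qed
  have bound: "norm (scaled_weight q k n) \<le> 2 / 3 * C * (real k * r ^ k)" if "n > 0" for k n
  proof (cases "1 \<le> k \<and> k \<le> n")
    case True
    then have "norm (scaled_weight q k n) = 2 / 3 * real k * r ^ k * (sqrt (real n) * \<bar>saddle_coeff n k\<bar>)"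
      using r by (simp add: scaled_weight_eq[of k n q, folded r_def] abs_mult)
    also have "\<dots> \<le> 2 / 3 * real k * r ^ k * C"
      using True r by (intro mult_left_mono C) auto
    finally show ?thesis by (simp add: mult_ac)
  next
    case False
    then have "k = 0 \<or> k > n" by auto
    then have "scaled_weight q k n = 0"
      using that by (auto simp: scaled_weight_zero_contacts) (simp add: scaled_weight_def num_watermelons_eq_0)
    then show ?thesis using C0 r by simp
  qed
  have "(\<lambda>n. \<Sum>k. scaled_weight q k n) \<longlonglongrightarrow> (\<Sum>k. real k * r ^ k / (3 * sqrt pi))"
  proof (rule tannerys_theorem[where M = "\<lambda>k. 2 / 3 * C * (real k * r ^ k)", THEN conjunct2, THEN conjunct2])
    show "(\<lambda>n. scaled_weight q k n) \<longlonglongrightarrow> real k * r ^ k / (3 * sqrt pi)" for k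
      unfolding r_def by (rule scaled_weight_tendsto)
    show "eventually (\<lambda>(k, n). norm (scaled_weight q k n) \<le> 2 / 3 * C * (real k * r ^ k)) (at_top \<times>\<^sub>F sequentially)"
      unfolding eventually_prod_filter
      by (rule exI[of _ "\<lambda>_. True"], rule exI[of _ "\<lambda>n. n > 0"]) (use bound eventually_gt_at_top in auto)
    show "summable (\<lambda>k. 2 / 3 * C * (real k * r ^ k))"
      using sums by (intro summable_mult) (rule sums_summable)
  qed auto
  also have "(\<Sum>k. real k * r ^ k / (3 * sqrt pi)) = r / (1 - r)\<^sup>2 / (3 * sqrt pi)"
    using sums_divide[OF sums] by (rule sums_unique[symmetric])
  finally show ?thesis by (simp only: suminf_scaled_weight r_def)
qed

lemma subcritical_pmf_tendsto:
  assumes q: "0 < q" "q < 4/3"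
  shows "(\<lambda>n. pmf (contacts_pmf q n) k) \<longlonglongrightarrow>
           (if k = 0 then 0 else pmf (neg_binomial_pmf 2 (1 - 3/4 * q)) (k - 1))"
proof -
  define r where "r = 3/4 * q"
  have r: "0 < r" "r < 1" using q by (auto simp: r_def)
  have "(\<lambda>n. scaled_weight q k n / (real n * sqrt (real n) / 4 ^ n * watermelon_weight q n)) \<longlonglongrightarrow>
          (real k * r ^ k / (3 * sqrt pi)) / (r / (1 - r)\<^sup>2 / (3 * sqrt pi))"
    unfolding r_def using r r_def
    by (intro tendsto_divide scaled_weight_tendsto subcritical_weight_tendsto q) auto
  also have "(real k * r ^ k / (3 * sqrt pi)) / (r / (1 - r)\<^sup>2 / (3 * sqrt pi)) =
               (if k = 0 then 0 else pmf (neg_binomial_pmf 2 (1 - r)) (k - 1))"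
    using r by (cases k) (auto simp: pmf_neg_binomial field_simps)
  finally show ?thesis
    unfolding r_def
  proof (rule Lim_transform_eventually)
    show "eventually (\<lambda>n. scaled_weight q k n / (real n * sqrt (real n) / 4 ^ n * watermelon_weight q n) =
            pmf (contacts_pmf q n) k) sequentially"
      using eventually_gt_at_top[of 0]
      by eventually_elim (simp add: scaled_weight_def pmf_contacts q)
  qed
qed

text \<open>Each distribution function is a sum over finitely many k, so convergence of the point
  probabilities suffices.\<close>

theorem subcritical_weak_conv:
  assumes q: "0 < q" "q < 4/3"
  shows "weak_conv_m (\<lambda>n. distr (contacts_pmf q n) borel (\<lambda>k. real k - 1))
                     (distr (neg_binomial_pmf 2 (1 - 3/4 * q)) borel real)"
proof -
  let ?N = "neg_binomial_pmf 2 (1 - 3/4 * q)"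
  have "(\<lambda>n. cdf (distr (contacts_pmf q n) borel (\<lambda>k. real k - 1)) x) \<longlonglongrightarrow> cdf (distr ?N borel real) x" for x
  proof -
    define A where "A = {k. real k - 1 \<le> x}"
    define B where "B = {k. real k \<le> x}"
    have "k \<le> nat \<lfloor>x + 1\<rfloor>" if "k \<in> A" for k
      using that by (intro le_nat_floor) (simp add: A_def)
    then have "A \<subseteq> {..nat \<lfloor>x + 1\<rfloor>}" by blast
    then have A: "finite A" by (rule finite_subset) simp
    have "B \<subseteq> {..nat \<lfloor>x\<rfloor>}" by (auto simp: B_def le_nat_floor)
    then have B: "finite B" by (rule finite_subset) simp
    have "(\<lambda>n. \<Sum>k\<in>A. pmf (contacts_pmf q n) k) \<longlonglongrightarrow> (\<Sum>k\<in>A. if k = 0 then 0 else pmf ?N (k - 1))"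
      by (intro tendsto_sum subcritical_pmf_tendsto q)
    also have "(\<Sum>k\<in>A. if k = 0 then 0 else pmf ?N (k - 1)) = (\<Sum>k\<in>A - {0}. pmf ?N (k - 1))"
      using A by (intro sum.mono_neutral_cong_right) auto
    \<comment> \<open>The shift by one: k contacts correspond to the value k - 1, and zero contacts
      have limiting probability 0.\<close>
    also have "\<dots> = (\<Sum>k\<in>B. pmf ?N k)"
      by (rule sum.reindex_bij_witness[of _ Suc "\<lambda>k. k - 1"]) (auto simp: A_def B_def of_nat_diff Suc_le_eq)
    finally show ?thesis
      using A B unfolding cdf_distr_pmf A_def B_def by (simp add: measure_measure_pmf_finite)
  qed
  then show ?thesis by (simp add: weak_conv_m_def weak_conv_def)
qed

section \<open>Critical weight: local limit law and Rayleigh law\<close>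

lemma critical_pmf_eq:
  assumes "1 \<le> k" "k \<le> n"
  shows "sqrt (real n) * pmf (contacts_pmf (4/3) n) k =
           2 / 3 * (real k / sqrt (real n)) * (sqrt (real n) * saddle_coeff n k) /
             (sqrt (real n) * watermelon_weight (4/3) n / 4 ^ n)"
proof -
  \<comment> \<open>At the critical weight the exponential factors in k cancel, leaving k / n times
    the saddle integral.\<close>
  have "(3/4) ^ k * (4/3) ^ k = (1 :: real)"
    by (simp flip: power_mult_distrib)
  then have *: "real (num_watermelons n k) * (4/3) ^ k = 4 ^ n * (2 * real k / (3 * real n)) * saddle_coeff n k"
    unfolding num_watermelons_saddle[OF assms] by simp
  define s where "s = sqrt (real n)"
  have s: "s > 0" "real n = s * s" using assms by (auto simp: s_def)
  show ?thesis
    unfolding pmf_contacts[of "4/3", simplified] * s_def[symmetric] s(2)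
    using s(1) by (simp add: field_simps)
qed

lemma critical_pmf_tendsto:
  fixes k :: "nat \<Rightarrow> nat"
  assumes ev: "eventually (\<lambda>n. 1 \<le> k n \<and> k n \<le> n) sequentially"
    and lim: "(\<lambda>n. real (k n) / sqrt n) \<longlonglongrightarrow> x"
  shows "(\<lambda>n. sqrt (real n) * pmf (contacts_pmf (4/3) n) (k n)) \<longlonglongrightarrow> 2 * x / 9 * exp (- x\<^sup>2 / 9)"
proof -
  have "(\<lambda>n. 2 / 3 * (real (k n) / sqrt (real n)) * (sqrt (real n) * saddle_coeff n (k n)) /
             (sqrt (real n) * watermelon_weight (4/3) n / 4 ^ n)) \<longlonglongrightarrow>
         2 / 3 * x * (exp (- x\<^sup>2 / 9) / (2 * sqrt pi)) / (3 / (2 * sqrt pi))"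
    by (intro tendsto_divide tendsto_mult tendsto_const lim saddle_coeff_tendsto[OF ev lim]
              watermelon_weight_critical_tendsto) auto
  then have "(\<lambda>n. sqrt (real n) * pmf (contacts_pmf (4/3) n) (k n)) \<longlonglongrightarrow>
         2 / 3 * x * (exp (- x\<^sup>2 / 9) / (2 * sqrt pi)) / (3 / (2 * sqrt pi))"
    by (rule Lim_transform_eventually)
       (use ev in eventually_elim, simp only: critical_pmf_eq)
  then show ?thesis by (simp add: field_simps)
qed

text \<open>The bound is linear in k / sqrt n, hence bounded on compact sets of the rescaled
  variable. The threshold N comes from bounding the normalised weight below by half of its
  limit.\<close>

lemma critical_pmf_bounded:
  obtains C N where "N > 0" "C \<ge> 0"
    "\<And>n k. n \<ge> N \<Longrightarrow> sqrt (real n) * pmf (contacts_pmf (4/3) n) k \<le> C * (real k / sqrt (real n))"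
proof -
  obtain C where C: "\<And>n k. 1 \<le> k \<Longrightarrow> k \<le> n \<Longrightarrow> sqrt (real n) * \<bar>saddle_coeff n k\<bar> \<le> C"
    using saddle_coeff_bounded by blast
  have C0: "C \<ge> 0" using order_trans[OF _ C[of 1 1]] by simp
  define W where "W = (\<lambda>n. sqrt (real n) * watermelon_weight (4/3) n / 4 ^ n)"
  have "3 / (2 * sqrt pi) > 3 / (4 * sqrt pi)"
    by (simp add: field_simps)
  from order_tendstoD(1)[OF watermelon_weight_critical_tendsto this]
  obtain N0 where N0: "\<And>n. n \<ge> N0 \<Longrightarrow> W n > 3 / (4 * sqrt pi)"
    by (auto simp: eventually_sequentially W_def)
  have "3 / (4 * sqrt pi) > 0" by simp
  show ?thesis
  proof (rule that[of "Suc N0" "2 / 3 * C / (3 / (4 * sqrt pi))"])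
    fix n k assume n: "n \<ge> Suc N0"
    show "sqrt (real n) * pmf (contacts_pmf (4/3) n) k \<le> 2 / 3 * C / (3 / (4 * sqrt pi)) * (real k / sqrt (real n))"
    proof (cases "1 \<le> k \<and> k \<le> n")
      case True
      then have "sqrt (real n) * pmf (contacts_pmf (4/3) n) k =
           2 / 3 * (real k / sqrt (real n)) * (sqrt (real n) * saddle_coeff n k) / W n"
        unfolding W_def by (intro critical_pmf_eq) auto
      also have "\<dots> \<le> 2 / 3 * (real k / sqrt (real n)) * C / W n"
      proof (intro divide_right_mono mult_left_mono)
        show "sqrt (real n) * saddle_coeff n k \<le> C"
          using True by (intro order_trans[OF _ C[of k n]] mult_left_mono) auto
        show "0 \<le> W n"
          using N0[of n] n \<open>3 / (4 * sqrt pi) > 0\<close> by linarith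
      qed auto
      also have "\<dots> \<le> 2 / 3 * (real k / sqrt (real n)) * C / (3 / (4 * sqrt pi))"
        using less_trans[OF \<open>3 / (4 * sqrt pi) > 0\<close> N0[of n]] N0[of n] n C0
        by (intro divide_left_mono mult_pos_pos mult_nonneg_nonneg) auto
      finally show ?thesis by (simp add: mult_ac)
    next
      case False
      then have "k = 0 \<or> k > n" by auto
      then have "num_watermelons n k = 0"
        using n num_watermelons_0_right[of n] num_watermelons_eq_0[of n k] by auto
      then show ?thesis using C0 by (simp add: pmf_contacts)
    qed
  qed (use C0 in auto)
qed

text \<open>Each cell of length 1 / r carries the mass \<open>f k\<close>. With r = sqrt n, sums of
  probabilities become integrals, to which the local limit law applies under the integral
  sign.\<close>

lemma step_function_has_integral:
  fixes f :: "nat \<Rightarrow> real"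
  assumes r: "r > 0"
  shows "((\<lambda>s. r * f (nat \<lfloor>s * r\<rfloor>)) has_integral (\<Sum>k<m. f k)) {0..real m / r}"
proof (induction m)
  case (Suc m)
  have "((\<lambda>s. r * f (nat \<lfloor>s * r\<rfloor>)) has_integral f m) {real m / r..real (Suc m) / r}"
  \<comment> \<open>At the right end point the floor has already jumped to the next cell.\<close>
  proof (rule has_integral_spike_finite[of "{real (Suc m) / r}"])
    fix s assume s: "s \<in> {real m / r..real (Suc m) / r} - {real (Suc m) / r}"
    then have "real m / r \<le> s" "s < real (Suc m) / r" by auto
    then have "real m \<le> s * r" "s * r < real m + 1"
      using r by (auto simp: field_simps)
    then have "\<lfloor>s * r\<rfloor> = int m" by (intro floor_unique) auto
    then show "r * f (nat \<lfloor>s * r\<rfloor>) = r * f m" by simp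
  next
    have "((\<lambda>s. r * f m) has_integral (real (Suc m) / r - real m / r) *\<^sub>R (r * f m)) {real m / r..real (Suc m) / r}"
      using r by (intro has_integral_const_real[THEN has_integral_eq_rhs]) (auto simp: divide_right_mono)
    then show "((\<lambda>s. r * f m) has_integral f m) {real m / r..real (Suc m) / r}"
      using r by (simp add: field_simps)
  qed simp
  from has_integral_combine[OF _ _ Suc.IH this] r show ?case
    by (simp add: divide_right_mono)
next
  case 0
  show ?case by (simp add: has_integral_null_real[of 0 0, simplified])
qed

lemma cdf_rayleigh_distribution:
  "cdf (rayleigh_distribution (sqrt 2)) x = (if x < 0 then 0 else 1 - exp (- x\<^sup>2 / 4))"
proof -
  have [measurable]: "rayleigh_density (sqrt 2) \<in> borel_measurable borel"
    unfolding rayleigh_density_def by measurable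
  have "emeasure (rayleigh_distribution (sqrt 2)) {..x} =
          (\<integral>\<^sup>+t. ennreal (rayleigh_density (sqrt 2) t) * indicator {..x} t \<partial>lborel)"
    unfolding rayleigh_distribution_def by (subst emeasure_density) auto
  also have "\<dots> = ennreal (if x < 0 then 0 else 1 - exp (- x\<^sup>2 / 4))"
  proof (cases "x < 0")
    case True
    then have "(\<lambda>t. ennreal (rayleigh_density (sqrt 2) t) * indicator {..x} t) = (\<lambda>t. 0)"
      by (auto simp: rayleigh_density_def indicator_def fun_eq_iff)
    then show ?thesis using True by simp
  next
    case False
    have eq: "(\<lambda>t. ennreal (rayleigh_density (sqrt 2) t) * indicator {..x} t) =
            (\<lambda>t. ennreal (t / 2 * exp (- t\<^sup>2 / 4)) * indicator {0..x} t)"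
      by (auto simp: rayleigh_density_def indicator_def fun_eq_iff)
    have "(\<integral>\<^sup>+t. ennreal (t / 2 * exp (- t\<^sup>2 / 4)) * indicator {0..x} t \<partial>lborel) =
                 (- exp (- x\<^sup>2 / 4)) - (- exp (- 0\<^sup>2 / 4))"
      using False by (intro nn_integral_FTC_Icc) (auto intro!: derivative_eq_intros)
    then show ?thesis unfolding eq using False by simp
  qed
  finally show ?thesis
    by (simp add: cdf_def measure_def)
qed

lemma critical_density_has_integral:
  fixes y :: real
  assumes "y \<ge> 0"
  shows "((\<lambda>s. 2 * s / 9 * exp (- s\<^sup>2 / 9)) has_integral 1 - exp (- y\<^sup>2 / 9)) {0..y}"
proof -
  have "((\<lambda>s. 2 * s / 9 * exp (- s\<^sup>2 / 9)) has_integral (- exp (- y\<^sup>2 / 9)) - (- exp (- 0\<^sup>2 / 9))) {0..y}"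
    using assms
    by (intro fundamental_theorem_of_calculus)
       (auto intro!: derivative_eq_intros simp flip: has_real_derivative_iff_has_vector_derivative)
  then show ?thesis by simp
qed

lemma tendsto_sandwich_inverse_sqrt:
  fixes f :: "nat \<Rightarrow> real"
  assumes "\<And>n::nat. n > 0 \<Longrightarrow> \<bar>f n - c\<bar> \<le> 1 / sqrt n"
  shows "f \<longlonglongrightarrow> (c :: real)"
proof (rule LIM_zero_cancel, rule Lim_null_comparison)
  show "eventually (\<lambda>n. norm (f n - c) \<le> 1 / sqrt n) sequentially"
    using eventually_gt_at_top[of 0] by eventually_elim (use assms in auto)
  show "(\<lambda>n. 1 / sqrt (real n)) \<longlonglongrightarrow> 0"
    by (rule divide_sqrt_tendsto_0)
qed

lemma critical_prob_tendsto:
  assumes y: "y \<ge> 0"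
  shows "(\<lambda>n. measure_pmf.prob (contacts_pmf (4/3) n) {..nat \<lfloor>y * sqrt n\<rfloor>}) \<longlonglongrightarrow> 1 - exp (- y\<^sup>2 / 9)"
proof -
  define P where "P = (\<lambda>n. pmf (contacts_pmf (4/3) n))"
  define m where "m = (\<lambda>n::nat. Suc (nat \<lfloor>y * sqrt n\<rfloor>))"
  define g where "g = (\<lambda>s::real. 2 * s / 9 * exp (- s\<^sup>2 / 9))"
  \<comment> \<open>The natural upper limit m n / sqrt n depends on n but lies in (y, y + 1];
    extending by 0 allows integration over the fixed interval up to y + 1.\<close>
  define F where "F = (\<lambda>n s. if s \<in> {0..real (m n) / sqrt n} then sqrt n * P n (nat \<lfloor>s * sqrt n\<rfloor>) else 0)"
  obtain C N where C: "N > 0" "C \<ge> 0"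
     "\<And>n k. n \<ge> N \<Longrightarrow> sqrt (real n) * pmf (contacts_pmf (4/3) n) k \<le> C * (real k / sqrt (real n))"
    by (rule critical_pmf_bounded) blast
  have floor: "real (nat \<lfloor>s * sqrt n\<rfloor>) \<le> s * sqrt n" "s * sqrt n < real (nat \<lfloor>s * sqrt n\<rfloor>) + 1"
    if "s \<ge> 0" for s and n :: nat
    using that by (auto simp: of_nat_nat)
  have m_bounds: "y < real (m n) / sqrt n" "real (m n) / sqrt n \<le> y + 1 / sqrt n" if "n > 0" for n
  proof -
    define r where "r = sqrt (real n)"
    have "r > 0" using that by (simp add: r_def)
    moreover have "real (m n) \<le> y * r + 1" "y * r < real (m n)"
      using floor[OF y, of n] unfolding m_def r_def of_nat_Suc by linarith+
    ultimately show "y < real (m n) / sqrt n" "real (m n) / sqrt n \<le> y + 1 / sqrt n"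
      unfolding r_def[symmetric] by (auto simp: field_simps)
  qed
  have m_le: "real (m n) / sqrt n \<le> y + 1" if "n > 0" for n
  proof -
    have "1 / sqrt (real n) \<le> 1" using that by simp
    then show ?thesis using m_bounds(2)[OF that] by linarith
  qed
  have F_int: "(F n has_integral (\<Sum>k<m n. P n k)) {0..y+1}" if "n > 0" for n
    unfolding F_def using m_le[OF that] that
    by (subst has_integral_restrict) (auto intro!: step_function_has_integral)
  have "(\<lambda>n. integral {0..y+1} (F (n + N))) \<longlonglongrightarrow> integral {0..y+1} (\<lambda>s. if s \<in> {0..y} then g s else 0)"
  proof (rule dominated_convergence(2)[where h = "\<lambda>_. C * (y + 1)"])
    show "F (n + N) integrable_on {0..y+1}" for n
      using F_int[of "n + N"] C(1) by (auto simp: integrable_on_def)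
    show "norm (F (n + N) s) \<le> C * (y + 1)" if s: "s \<in> {0..y+1}" for n s
    proof (cases "s \<in> {0..real (m (n + N)) / sqrt (real (n + N))}")
      case True
      have "norm (F (n + N) s) = sqrt (real (n + N)) * P (n + N) (nat \<lfloor>s * sqrt (real (n + N))\<rfloor>)"
        using True by (simp add: F_def P_def)
      also have "\<dots> \<le> C * (real (nat \<lfloor>s * sqrt (real (n + N))\<rfloor>) / sqrt (real (n + N)))"
        unfolding P_def by (rule C(3)) simp
      also have "\<dots> \<le> C * s"
        using C(1,2) floor(1)[of s "n + N"] s by (intro mult_left_mono) (auto simp: field_simps)
      also have "\<dots> \<le> C * (y + 1)"
        using C(2) s by (intro mult_left_mono) auto
      finally show ?thesis .
    qed (use C(2) y in \<open>auto simp: F_def\<close>)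
    show "(\<lambda>n. F (n + N) s) \<longlonglongrightarrow> (if s \<in> {0..y} then g s else 0)" if s: "s \<in> {0..y+1}" for s
    proof (rule LIMSEQ_ignore_initial_segment)
      consider "s = 0" | "0 < s" "s \<le> y" | "s > y" using s by fastforce
      then show "(\<lambda>n. F n s) \<longlonglongrightarrow> (if s \<in> {0..y} then g s else 0)"
      proof cases
        \<comment> \<open>At s = 0 the relevant probability is that of no contact, which vanishes
          for positive n because the end point is a contact.\<close>
        case 1
        have "eventually (\<lambda>n. F n s = 0) sequentially"
          using eventually_gt_at_top[of 0]
          by eventually_elim (simp add: 1 F_def P_def pmf_contacts num_watermelons_0_right)
        then show ?thesis using 1 y by (simp add: g_def tendsto_eventually)
      next
        case 2
        have "\<bar>real (nat \<lfloor>s * sqrt n\<rfloor>) / sqrt n - s\<bar> \<le> 1 / sqrt n" if "n > 0" for n :: nat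
        proof -
          define r k where "r = sqrt (real n)" and "k = real (nat \<lfloor>s * sqrt n\<rfloor>)"
          have "r > 0" using that by (simp add: r_def)
          moreover have "k \<le> s * r" "s * r < k + 1"
            using floor[of s n] 2 unfolding r_def k_def by linarith+
          moreover have "k / r - s = (k - s * r) / r" using \<open>r > 0\<close> by (simp add: field_simps)
          ultimately have "\<bar>k / r - s\<bar> \<le> 1 / r" by (auto simp: abs_divide intro!: divide_right_mono)
          then show ?thesis by (simp only: r_def k_def)
        qed
        then have lim: "(\<lambda>n. real (nat \<lfloor>s * sqrt (real n)\<rfloor>) / sqrt (real n)) \<longlonglongrightarrow> s"
          by (rule tendsto_sandwich_inverse_sqrt)
        have "filterlim (\<lambda>n. s * sqrt (real n)) at_top sequentially"
          by (intro filterlim_tendsto_pos_mult_at_top[OF tendsto_const 2(1)]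
                filterlim_compose[OF sqrt_at_top filterlim_real_sequentially])
        then have ev1: "eventually (\<lambda>n. 1 \<le> s * sqrt (real n)) sequentially"
          by (simp add: filterlim_at_top)
        have "filterlim (\<lambda>n. sqrt (real n)) at_top sequentially"
          by (intro filterlim_compose[OF sqrt_at_top filterlim_real_sequentially])
        then have ev2: "eventually (\<lambda>n. s \<le> sqrt (real n)) sequentially"
          by (simp add: filterlim_at_top)
        have ev: "eventually (\<lambda>n. 1 \<le> nat \<lfloor>s * sqrt n\<rfloor> \<and> nat \<lfloor>s * sqrt n\<rfloor> \<le> n) sequentially"
          using ev1 ev2
        proof eventually_elim
          case (elim n)
          have "real (nat \<lfloor>s * sqrt n\<rfloor>) \<le> s * sqrt n"
            using floor(1)[of s n] 2 by simp
          also have "\<dots> \<le> sqrt n * sqrt n"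
            using elim by (intro mult_right_mono) auto
          finally have "real (nat \<lfloor>s * sqrt n\<rfloor>) \<le> real n" by simp
          moreover have "1 \<le> nat \<lfloor>s * sqrt n\<rfloor>" using elim(1) by (simp add: le_nat_floor)
          ultimately show ?case by simp
        qed
        have "(\<lambda>n. sqrt (real n) * P n (nat \<lfloor>s * sqrt n\<rfloor>)) \<longlonglongrightarrow> g s"
          unfolding P_def g_def using ev lim by (rule critical_pmf_tendsto)
        then have "(\<lambda>n. F n s) \<longlonglongrightarrow> g s"
        proof (rule Lim_transform_eventually)
          show "eventually (\<lambda>n. sqrt (real n) * P n (nat \<lfloor>s * sqrt n\<rfloor>) = F n s) sequentially"
            using eventually_gt_at_top[of 0]
          proof eventually_elim
            case (elim n)
            have "s \<le> real (m n) / sqrt n"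
              using m_bounds(1)[OF elim] 2 by linarith
            then show ?case unfolding F_def using 2(1) by auto
          qed
        qed
        then show ?thesis using 2 by simp
      next
        case 3
        have "(\<lambda>n. real (m n) / sqrt n) \<longlonglongrightarrow> y"
        proof (rule tendsto_sandwich_inverse_sqrt)
          show "\<bar>real (m n) / sqrt n - y\<bar> \<le> 1 / sqrt n" if "n > 0" for n
            using m_bounds[OF that] by linarith
        qed
        from order_tendstoD(2)[OF this 3] have "eventually (\<lambda>n. F n s = 0) sequentially"
          by eventually_elim (auto simp: F_def)
        then show ?thesis using 3 by (simp add: tendsto_eventually)
      qed
    qed
  qed auto
  also have "integral {0..y+1} (\<lambda>s. if s \<in> {0..y} then g s else 0) = 1 - exp (- y\<^sup>2 / 9)"
    using critical_density_has_integral[OF y] unfolding g_def[symmetric]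
    by (intro integral_unique) (subst has_integral_restrict, auto)
  also have "(\<lambda>n. integral {0..y+1} (F (n + N))) =
               (\<lambda>n. measure_pmf.prob (contacts_pmf (4/3) (n + N)) {..nat \<lfloor>y * sqrt (n + N)\<rfloor>})"
  proof
    fix n
    have "integral {0..y+1} (F (n + N)) = (\<Sum>k<m (n + N). P (n + N) k)"
      using F_int[of "n + N"] C(1) by (intro integral_unique) auto
    then show "integral {0..y+1} (F (n + N)) = measure_pmf.prob (contacts_pmf (4/3) (n + N)) {..nat \<lfloor>y * sqrt (n + N)\<rfloor>}"
      by (simp add: measure_measure_pmf_finite P_def m_def lessThan_Suc_atMost)
  qed
  finally show ?thesis by (rule LIMSEQ_offset)
qed

theorem critical_weak_conv:
  "weak_conv_m (\<lambda>n. distr (contacts_pmf (4/3) n) borel (\<lambda>k. 2/3 * (real k / sqrt (real n))))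
               (rayleigh_distribution (sqrt 2))"
proof -
  have "(\<lambda>n. cdf (distr (contacts_pmf (4/3) n) borel (\<lambda>k. 2/3 * (real k / sqrt (real n)))) x) \<longlonglongrightarrow>
          cdf (rayleigh_distribution (sqrt 2)) x" for x
  proof (cases "x < 0")
    case True
    then have "{k. 2/3 * (real k / sqrt (real n)) \<le> x} = {}" for n
      by (auto simp: not_le intro!: less_le_trans[of x 0])
    then show ?thesis using True by (simp add: cdf_distr_pmf cdf_rayleigh_distribution)
  next
    case False
    \<comment> \<open>Undoing the factor 2/3 by y = 3 x / 2 turns y^2 / 9 into x^2 / 4, the exponent
      of the Rayleigh law with variance parameter 2.\<close>
    have "(\<lambda>n. measure_pmf.prob (contacts_pmf (4/3) n) {..nat \<lfloor>(3/2 * x) * sqrt n\<rfloor>}) \<longlonglongrightarrow> 1 - exp (- (3/2 * x)\<^sup>2 / 9)"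
      using False by (intro critical_prob_tendsto) auto
    moreover have "eventually (\<lambda>n. {..nat \<lfloor>(3/2 * x) * sqrt n\<rfloor>} = {k. 2/3 * (real k / sqrt (real n)) \<le> x}) sequentially"
      using eventually_gt_at_top[of 0]
    proof eventually_elim
      case (elim n)
      have "k \<le> nat \<lfloor>(3/2 * x) * sqrt n\<rfloor> \<longleftrightarrow> real k \<le> (3/2 * x) * sqrt n" for k
        using False by (simp add: le_nat_iff le_floor_iff)
      then show ?case using elim by (auto simp: field_simps)
    qed
    ultimately have "(\<lambda>n. measure_pmf.prob (contacts_pmf (4/3) n) {k. 2/3 * (real k / sqrt (real n)) \<le> x}) \<longlonglongrightarrow>
        1 - exp (- (3/2 * x)\<^sup>2 / 9)"
      by (rule Lim_transform_eventually[OF _ eventually_mono]) simp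
    then show ?thesis
      using False by (simp add: cdf_distr_pmf cdf_rayleigh_distribution power_mult_distrib power_divide)
  qed
  then show ?thesis by (simp add: weak_conv_m_def weak_conv_def)
qed

section \<open>The supercritical regime\<close>

text \<open>In the variable y (1 - y) this is the geometric series with a simple pole at
  \<open>z\<close>; multiplying by the denominator gives the recursion.\<close>

lemma zcoeff_inverse_pole:
  assumes "z \<noteq> 0"
  shows "zcoeff n (inverse (fps_const z - fps_X * (1 - fps_X))) = 1 / z ^ Suc n"
proof (induction n)
  case 0
  show ?case by (simp add: inverse_eq_divide)
next
  case (Suc n)
  define Q where "Q = fps_const z - fps_X * (1 - fps_X)"
  have "Q * inverse Q = 1"
    by (rule inverse_mult_eq_1') (simp add: Q_def assms)
  then have "fps_const z * inverse Q = 1 + fps_X * (1 - fps_X) * inverse Q"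
    by (simp add: Q_def algebra_simps)
  then have "zcoeff (Suc n) (fps_const z * inverse Q) = zcoeff (Suc n) 1 + zcoeff n (inverse Q)"
    by (simp only: zcoeff_add zcoeff_Suc)
  then have "z * zcoeff (Suc n) (inverse Q) = zcoeff n (inverse Q)"
    by (simp add: zcoeff_const_mult zcoeff_1)
  then have "zcoeff (Suc n) (inverse Q) = zcoeff n (inverse Q) / z"
    using assms by (simp add: field_simps)
  then show ?case
    using Suc.IH by (simp add: Q_def mult.commute)
qed

text \<open>
  The only pole in \<open>\<bar>y\<bar> \<le> 1/2\<close> is \<open>y = 1 - w\<close>, and the first summand isolates it as a simple pole
  in \<open>z\<close>.
\<close>
lemma inverse_ret_gf_partial_fractions:
  fixes u w :: complex
  assumes w: "w \<noteq> 0" "1 - w \<noteq> 0" "1 + w \<noteq> 0" and u: "u \<noteq> 0" "1 - w\<^sup>2 = 1 / u"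
  shows "inverse (1 - fps_const u * ret_gf) =
           fps_const ((2 * w - 1) / (2 * u * w)) * inverse (fps_const (w * (1 - w)) - fps_X * (1 - fps_X)) +
           fps_const (1 / (2 * u * w)) * (inverse (fps_const (1 + w) - fps_X) * inverse (fps_const w - fps_X))"
proof -
  \<comment> \<open>The roots of 1 - u y (2 - y) are 1 - w and 1 + w, while w is the other preimage
    of w (1 - w) under y (1 - y). Thus a c is the denominator of a pole in z, and writing c as a
    combination of a and b splits c / (a b c) into a multiple of 1 / (a c) and a remainder free of
    a.\<close>
  define a b c where "a = fps_const (1 - w) - fps_X" "b = fps_const (1 + w) - fps_X" "c = fps_const w - fps_X"
  have units: "a * inverse a = 1" "b * inverse b = 1" "c * inverse c = 1"
    unfolding a_b_c_def by (rule inverse_mult_eq_1', use w in simp)+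
  have eq1: "1 - fps_const u * ret_gf = fps_const u * (a * b)"
  proof -
    have "fps_const u * (a * b) = fps_const (u * (1 - w\<^sup>2)) - fps_const u * ret_gf"
      by (simp add: a_b_c_def ret_gf_def algebra_simps power2_eq_square numeral_fps_const
            flip: fps_const_mult fps_const_add fps_const_sub)
    also have "u * (1 - w\<^sup>2) = 1" using u by simp
    finally show ?thesis by simp
  qed
  have eq2: "fps_const (w * (1 - w)) - fps_X * (1 - fps_X) = a * c"
    by (simp add: a_b_c_def algebra_simps flip: fps_const_mult fps_const_add fps_const_sub)
  have eq3: "c = fps_const ((2 * w - 1) / (2 * w)) * b + fps_const (1 / (2 * w)) * a"
  proof -
    have "(2 * w - 1) / (2 * w) * (1 + w) + 1 / (2 * w) * (1 - w) = w" "(2 * w - 1) / (2 * w) + 1 / (2 * w) = 1"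
      using w by (simp_all add: field_simps)
    then have "c = fps_const ((2 * w - 1) / (2 * w) * (1 + w) + 1 / (2 * w) * (1 - w)) -
                     fps_const ((2 * w - 1) / (2 * w) + 1 / (2 * w)) * fps_X"
      by (simp add: a_b_c_def)
    then show ?thesis
      unfolding a_b_c_def fps_const_add[symmetric] fps_const_mult[symmetric]
      by (simp only: ring_distribs) (simp add: algebra_simps)
  qed
  have "fps_const (1 / u) * (inverse a * inverse b) = fps_const (1 / u) * (inverse a * inverse b) * (c * inverse c)"
    by (simp add: units)
  also have "\<dots> = fps_const (1 / u) * fps_const ((2 * w - 1) / (2 * w)) * (inverse a * inverse c) * (b * inverse b) +
                  fps_const (1 / u) * fps_const (1 / (2 * w)) * (inverse b * inverse c) * (a * inverse a)"
    by (subst (1) eq3) (simp only: ring_distribs mult_ac)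
  finally have "fps_const (1 / u) * (inverse a * inverse b) =
      fps_const ((2 * w - 1) / (2 * u * w)) * (inverse a * inverse c) + fps_const (1 / (2 * u * w)) * (inverse b * inverse c)"
    by (simp add: units mult_ac)
  moreover have "inverse (1 - fps_const u * ret_gf) = fps_const (1 / u) * (inverse a * inverse b)"
    unfolding eq1 by (simp add: fps_inverse_mult fps_const_inverse divide_inverse)
  moreover have "inverse (fps_const (w * (1 - w)) - fps_X * (1 - fps_X)) = inverse a * inverse c"
    unfolding eq2 by (simp add: fps_inverse_mult)
  ultimately show ?thesis
    by (simp add: a_b_c_def)
qed

text \<open>The poles w and 1 + w lie outside the disc of radius 1/2: the first by the margin
  \<open>\<delta>\<close>, the second because Re w >= 0. Cauchy's inequality on this circle then
  gives the growth 4^n of the square-root singularity.\<close>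

lemma norm_zcoeff_remainder_le:
  fixes w :: complex
  assumes \<delta>: "\<delta> > 0" and w: "norm w \<ge> 1/2 + \<delta>" "Re w \<ge> 0"
  shows "norm (zcoeff n (inverse (fps_const (1 + w) - fps_X) * inverse (fps_const w - fps_X))) \<le> 8 / \<delta> * 4 ^ n"
proof -
  define g where "g = (\<lambda>y. inverse (1 + w - y) * inverse (w - y) * (1 - 2 * y) * inverse (1 - y) ^ Suc n)"
  have nz: "norm (1 + w - y) \<ge> 1/2" "norm (w - y) \<ge> \<delta>" "norm (1 - y) \<ge> 1/2" if "norm y \<le> 1/2" for y
  proof -
    have "Re y \<le> 1/2" using that complex_Re_le_cmod[of y] by linarith
    then show "norm (1 + w - y) \<ge> 1/2"
      using complex_Re_le_cmod[of "1 + w - y"] w by simp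
    show "norm (w - y) \<ge> \<delta>" using norm_triangle_ineq2[of w y] that w by linarith
    show "norm (1 - y) \<ge> 1/2" using norm_triangle_ineq2[of 1 y] that by simp
  qed
  have nz': "1 + w - y \<noteq> 0" "w - y \<noteq> 0" "1 - y \<noteq> 0" if "norm y \<le> 1/2" for y
    using nz[OF that] \<delta> by (auto simp del: norm_one)
  have "g has_fps_expansion inverse (fps_const (1 + w) - fps_X) * inverse (fps_const w - fps_X) *
          (1 - 2 * fps_X) * inverse (1 - fps_X) ^ Suc n"
    unfolding g_def using nz'[of 0] by (intro fps_expansion_intros) auto
  from fps_nth_fps_expansion[OF this, of n]
  have "norm (zcoeff n (inverse (fps_const (1 + w) - fps_X) * inverse (fps_const w - fps_X))) =
          norm ((deriv ^^ n) g 0) / fact n"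
    by (simp add: zcoeff_def norm_divide)
  also have "norm ((deriv ^^ n) g 0) \<le> fact n * (8 / \<delta> * 2 ^ n) / (1/2) ^ n"
  proof (rule Cauchy_inequality)
    show "g holomorphic_on ball 0 (1/2)"
      unfolding g_def using nz' by (intro holomorphic_intros) auto
    show "continuous_on (cball 0 (1/2)) g"
      unfolding g_def using nz' by (intro continuous_intros) auto
  next
    fix y :: complex assume "norm (0 - y) = 1/2"
    then have y: "norm y = 1/2" by simp
    have "norm (1 - 2 * y) \<le> 2"
      using norm_triangle_ineq4[of 1 "2 * y"] y by (simp add: norm_mult)
    moreover have "norm (inverse (1 + w - y)) \<le> 2" "norm (inverse (w - y)) \<le> 1 / \<delta>" "norm (inverse (1 - y)) \<le> 2"
      using nz[of y] y \<delta> le_imp_inverse_le[of "1/2" "norm (1 + w - y)"] le_imp_inverse_le[of \<delta> "norm (w - y)"]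
        le_imp_inverse_le[of "1/2" "norm (1 - y)"] by (auto simp: norm_divide inverse_eq_divide)
    \<comment> \<open>The powers of 1 / (1 - y) supply one factor 2^n; the other comes from the
      radius 1/2.\<close>
    ultimately have "norm (g y) \<le> 2 * (1 / \<delta>) * 2 * 2 ^ Suc n"
      unfolding g_def norm_mult norm_power using \<delta> by (intro mult_mono power_mono) auto
    then show "norm (g y) \<le> 8 / \<delta> * 2 ^ n" by simp
  qed simp
  also have "fact n * (8 / \<delta> * 2 ^ n) / (1/2) ^ n = fact n * (8 / \<delta> * 4 ^ n)"
  proof -
    have "(4 :: real) ^ n = 2 ^ n * 2 ^ n" by (simp flip: power_mult_distrib)
    then show ?thesis by (simp add: power_one_over)
  qed
  finally show ?thesis by (simp add: divide_right_mono)
qed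

text \<open>Multiplying by the n-th power of the pole w (1 - w) makes the main term independent of
  n. The remainder becomes (4 |w (1 - w)|)^n, exponentially small once the pole lies inside |z| <
  1/4.\<close>

lemma watermelon_gf_pole:
  fixes u w :: complex
  assumes \<delta>: "\<delta> > 0" and w: "norm w \<ge> 1/2 + \<delta>" "Re w \<ge> 0" "norm w \<le> 2" "w \<noteq> 1"
    and u: "u \<noteq> 0" "1 - w\<^sup>2 = 1 / u"
  shows "norm ((\<Sum>k\<le>n. of_nat (num_watermelons n k) * u ^ k) * (w * (1 - w)) ^ n - (2 * w - 1) * (1 + w) / (2 * w\<^sup>2))
           \<le> 40 / \<delta> * (4 * norm (w * (1 - w))) ^ n"
proof -
  define E where "E = zcoeff n (inverse (fps_const (1 + w) - fps_X) * inverse (fps_const w - fps_X))"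
  have nz: "w \<noteq> 0" "1 - w \<noteq> 0" "1 + w \<noteq> 0"
    using w \<delta> by (auto simp: complex_eq_iff[of "1 + w"])
  have "(\<Sum>k\<le>n. of_nat (num_watermelons n k) * u ^ k) =
          (2 * w - 1) / (2 * u * w) * (1 / (w * (1 - w)) ^ Suc n) + 1 / (2 * u * w) * E"
    unfolding watermelon_gf inverse_ret_gf_partial_fractions[OF nz u] zcoeff_add zcoeff_const_mult E_def
    by (subst zcoeff_inverse_pole) (use nz in auto)
  also have "\<dots> * (w * (1 - w)) ^ n =
      (2 * w - 1) / (2 * u * w) / (w * (1 - w)) + 1 / (2 * u * w) * E * (w * (1 - w)) ^ n"
  proof -
    have "(a * (1 / z ^ Suc n) + b) * z ^ n = a / z + b * z ^ n" if "z \<noteq> 0" for a b z :: complex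
      using that by (simp add: field_simps)
    moreover have "w * (1 - w) \<noteq> 0" using nz by simp
    ultimately show ?thesis .
  qed
  also have "(2 * w - 1) / (2 * u * w) / (w * (1 - w)) = (2 * w - 1) * (1 - w\<^sup>2) / (2 * w) / (w * (1 - w))"
    unfolding u(2) by simp
  also have "\<dots> = (2 * w - 1) * (1 + w) / (2 * w\<^sup>2)"
  proof -
    have "1 - w\<^sup>2 = (1 + w) * (1 - w)" by (simp add: power2_eq_square algebra_simps)
    then show ?thesis using nz by (simp add: power2_eq_square)
  qed
  finally have "norm ((\<Sum>k\<le>n. of_nat (num_watermelons n k) * u ^ k) * (w * (1 - w)) ^ n - (2 * w - 1) * (1 + w) / (2 * w\<^sup>2))
      = norm (1 / (2 * u * w)) * norm E * norm (w * (1 - w)) ^ n"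
    by (simp add: norm_mult norm_power norm_divide)
  also have "\<dots> \<le> 5 * (8 / \<delta> * 4 ^ n) * norm (w * (1 - w)) ^ n"
  proof (intro mult_right_mono mult_mono)
    show "norm E \<le> 8 / \<delta> * 4 ^ n"
      unfolding E_def by (rule norm_zcoeff_remainder_le[OF \<delta> w(1,2)])
    \<comment> \<open>Here 1 / u = 1 - w^2 has modulus at most 1 + 2^2 = 5 and 2 |w| is at least 1;
      together with 8 / \<delta> this yields the constant 40.\<close>
    have "norm (1 / (2 * u * w)) = norm (1 - w\<^sup>2) * (1 / (2 * norm w))"
      unfolding u(2) by (simp add: norm_divide norm_mult)
    also have "\<dots> \<le> 5 * 1"
    proof (intro mult_mono)
      have "norm (1 - w\<^sup>2) \<le> 1 + (norm w)\<^sup>2"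
        using norm_triangle_ineq4[of 1 "w\<^sup>2"] by (simp add: norm_power)
      also have "(norm w)\<^sup>2 \<le> 2\<^sup>2" using w by (intro power_mono) auto
      finally show "norm (1 - w\<^sup>2) \<le> 5" by simp
      have "2 * norm w \<ge> 1" using w \<delta> by linarith
      then show "1 / (2 * norm w) \<le> 1" by (simp add: divide_le_eq)
    qed auto
    finally show "norm (1 / (2 * u * w)) \<le> 5" by simp
  qed (use \<delta> in auto)
  finally show ?thesis by (simp add: power_mult_distrib mult_ac)
qed

section \<open>The dominant pole in a complex neighbourhood of t = 0\<close>

text \<open>
  For \<open>u = q * exp t\<close>, these are the \<open>w\<close> with \<open>w\<^sup>2 = 1 - 1 / u\<close> and the pole \<open>z = w (1 - w)\<close> of the
  generating function nearest to the origin.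
\<close>
definition tilt_root :: "real \<Rightarrow> complex \<Rightarrow> complex" where
  "tilt_root q t = csqrt (1 - exp (- t) / of_real q)"

definition tilt_pole :: "real \<Rightarrow> complex \<Rightarrow> complex" where
  "tilt_pole q t = tilt_root q t * (1 - tilt_root q t)"

text \<open>On a disc \<open>\<bar>t\<bar> \<le> \<rho>\<close> the pole stays inside the circle of convergence \<open>\<bar>z\<bar> = 1/4\<close> of the square root.\<close>
locale supercritical =
  fixes q \<rho> \<delta> \<theta> :: real
  assumes q: "q > 4/3" and \<rho>: "\<rho> > 0" and \<delta>: "\<delta> > 0" and \<theta>: "0 \<le> \<theta>" "\<theta> < 1"
    and radicand: "\<And>t. norm t \<le> \<rho> \<Longrightarrow> Re (1 - exp (- t) / of_real q) > 0"
    and root_bounds: "\<And>t. norm t \<le> \<rho> \<Longrightarrow> 1/2 + \<delta> \<le> norm (tilt_root q t)"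
                     "\<And>t. norm t \<le> \<rho> \<Longrightarrow> norm (tilt_root q t) \<le> 2"
    and pole_bounds: "\<And>t. norm t \<le> \<rho> \<Longrightarrow> 4 * norm (tilt_pole q t) \<le> \<theta>"
                     "\<And>t. norm t \<le> \<rho> \<Longrightarrow> Re (tilt_pole q t) > 0"

lemma tilt_root_0:
  assumes q: "q > 4/3"
  shows "tilt_root q 0 = of_real (sqrt (1 - 1 / q))" "1/2 < sqrt (1 - 1 / q)" "sqrt (1 - 1 / q) < 1"
proof -
  have *: "1 / q < 3 / 4" "1 / q > 0" using q by (simp_all add: field_simps)
  have "tilt_root q 0 = csqrt (of_real (1 - 1 / q))" by (simp add: tilt_root_def)
  then show "tilt_root q 0 = of_real (sqrt (1 - 1 / q))"
    using * q by (subst (asm) csqrt_of_real_nonneg) auto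
  have "sqrt (1/4) < sqrt (1 - 1 / q)" "sqrt (1 - 1 / q) < sqrt 1"
    unfolding real_sqrt_less_iff using * by auto
  then show "1/2 < sqrt (1 - 1 / q)" "sqrt (1 - 1 / q) < 1" by (simp_all add: real_sqrt_divide)
qed

text \<open>All required inequalities are strict at t = 0, where w = \<omega> lies strictly between
  1/2 and 1 and 4 \<omega> (1 - \<omega>) < 1 amounts to (2 \<omega> - 1)^2 > 0. Continuity extends
  them to a disc.\<close>

lemma supercritical_exists:
  assumes q: "q > 4/3"
  shows "\<exists>\<rho> \<delta> \<theta>. supercritical q \<rho> \<delta> \<theta>"
proof -
  define \<omega> where "\<omega> = sqrt (1 - 1 / q)"
  note root0 = tilt_root_0(1)[OF q, folded \<omega>_def] and \<omega> = tilt_root_0(2,3)[OF q, folded \<omega>_def]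
  have "1 / q < 3 / 4" using q by (simp add: field_simps)
  have pole0: "tilt_pole q 0 = of_real (\<omega> * (1 - \<omega>))"
    unfolding tilt_pole_def root0 by simp
  have norm0: "norm (tilt_pole q 0) = \<omega> * (1 - \<omega>)"
    unfolding pole0 norm_of_real using \<omega> by simp
  have small: "\<omega> * (1 - \<omega>) > 0" "4 * (\<omega> * (1 - \<omega>)) < 1"
  proof -
    have "(2 * \<omega> - 1)\<^sup>2 > 0" using \<omega> by simp
    then show "4 * (\<omega> * (1 - \<omega>)) < 1" by (simp add: power2_eq_square algebra_simps)
  qed (use \<omega> in auto)
  \<comment> \<open>Half the gap between \<omega> and 1/2, and the midpoint between 4 \<omega> (1 -
    \<omega>) and 1, leave room for perturbation.\<close>
  define \<delta> where "\<delta> = (\<omega> - 1/2) / 2"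
  define \<theta> where "\<theta> = (1 + 4 * (\<omega> * (1 - \<omega>))) / 2"
  have cont: "isCont (\<lambda>t::complex. 1 - exp (- t) / of_real q) 0"
    by (intro continuous_intros) (use q in auto)
  then have rad: "isCont (\<lambda>t::complex. Re (1 - exp (- t) / of_real q)) 0"
    unfolding isCont_def by (rule tendsto_Re)
  have rad0: "Re (1 - exp (- (0 :: complex)) / of_real q) > 0"
    using \<open>1 / q < 3 / 4\<close> by simp
  then have "1 - exp (- (0 :: complex)) / of_real q \<notin> \<real>\<^sub>\<le>\<^sub>0"
    unfolding complex_nonpos_Reals_iff by linarith
  then have root: "isCont (tilt_root q) 0"
    unfolding tilt_root_def[abs_def] by (intro isCont_o2[OF cont] continuous_at_csqrt)
  then have pole: "isCont (tilt_pole q) 0"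
    unfolding tilt_pole_def[abs_def] by (intro continuous_intros)
  have ev: "eventually (\<lambda>t. f t > c) (nhds 0)" if "isCont f 0" "f 0 > c" for f :: "complex \<Rightarrow> real" and c
  proof -
    have "(f \<longlongrightarrow> f 0) (nhds 0)"
      using that(1) unfolding isCont_def by (simp only: tendsto_at_iff_tendsto_nhds)
    then show ?thesis using that(2) by (rule order_tendstoD(1))
  qed
  \<comment> \<open>Upper bounds are negated so that \<open>ev\<close> applies to every
    conjunct.\<close>
  have "eventually (\<lambda>t. Re (1 - exp (- t) / of_real q) > 0 \<and> norm (tilt_root q t) > 1/2 + \<delta> \<and>
          - norm (tilt_root q t) > - 2 \<and> - (4 * norm (tilt_pole q t)) > - \<theta> \<and> Re (tilt_pole q t) > 0) (nhds 0)"
  proof (intro eventually_conj ev)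
    have "norm (tilt_root q 0) = \<omega>" unfolding root0 norm_of_real using \<omega> by simp
    then show "norm (tilt_root q 0) > 1/2 + \<delta>" "- norm (tilt_root q 0) > - 2"
      using \<omega> by (simp_all add: \<delta>_def field_simps)
    show "- (4 * norm (tilt_pole q 0)) > - \<theta>"
    proof -
      have "- ((1 + 4 * x) / 2) < - (4 * x)" if "4 * x < 1" for x :: real
        using that by (simp add: field_simps)
      from this[OF small(2)] show ?thesis unfolding norm0 \<theta>_def .
    qed
    show "Re (tilt_pole q 0) > 0"
      unfolding pole0 Re_complex_of_real by (rule small)
    show "isCont (\<lambda>t. Re (tilt_pole q t)) 0"
      using pole unfolding isCont_def by (rule tendsto_Re)
    show nroot: "isCont (\<lambda>t. norm (tilt_root q t)) 0"
      using root unfolding isCont_def by (rule tendsto_norm)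
    then show "isCont (\<lambda>t. - norm (tilt_root q t)) 0"
      unfolding isCont_def by (rule tendsto_minus)
    show "isCont (\<lambda>t. - (4 * norm (tilt_pole q t))) 0"
      using pole unfolding isCont_def by (intro tendsto_norm tendsto_minus tendsto_mult_left)
  qed (fact rad rad0)+
  then obtain r where r: "r > 0" "\<And>t. dist t 0 < r \<Longrightarrow> Re (1 - exp (- t) / of_real q) > 0 \<and> norm (tilt_root q t) > 1/2 + \<delta> \<and>
          - norm (tilt_root q t) > - 2 \<and> - (4 * norm (tilt_pole q t)) > - \<theta> \<and> Re (tilt_pole q t) > 0"
    unfolding eventually_nhds_metric by blast
  have "supercritical q (r / 2) \<delta> \<theta>"
  proof
    show "q > 4/3" by fact
    show "r / 2 > 0" "\<delta> > 0"
      using r(1) \<omega> by (simp_all add: \<delta>_def)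
    have "0 \<le> (1 + 4 * x) / 2 \<and> (1 + 4 * x) / 2 < 1" if "0 < x" "4 * x < 1" for x :: real
      using that by (simp add: field_simps)
    from this[OF small] show "0 \<le> \<theta>" "\<theta> < 1"
      unfolding \<theta>_def by blast+
  next
    fix t :: complex assume "norm t \<le> r / 2"
    then have "dist t 0 < r" using r(1) by simp
    from r(2)[OF this]
    show "Re (1 - exp (- t) / of_real q) > 0" "1/2 + \<delta> \<le> norm (tilt_root q t)" "norm (tilt_root q t) \<le> 2"
      "4 * norm (tilt_pole q t) \<le> \<theta>" "Re (tilt_pole q t) > 0" by auto
  qed
  then show ?thesis by blast
qed

context supercritical
begin

abbreviation "W \<equiv> tilt_root q"
abbreviation "Z \<equiv> tilt_pole q"

text \<open>This is both the limiting amplitude of the pole term and the derivative of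
  \<open>cumulant\<close>. Differentiating u R(z) = 1 along the pole z(t), where u = q e^t and R(z)
  = y (2 - y), gives - z' / z = 1 / (z u R'(z)), and the right-hand side is the amplitude of the
  simple pole.\<close>

definition drift :: "complex \<Rightarrow> complex" where
  "drift w = (2 * w - 1) * (1 + w) / (2 * w\<^sup>2)"

definition tilted_gf :: "nat \<Rightarrow> complex \<Rightarrow> complex" where
  "tilted_gf n t = (\<Sum>k\<le>n. of_nat (num_watermelons n k) * (of_real q * exp t) ^ k)"

definition scaled_gf :: "nat \<Rightarrow> complex \<Rightarrow> complex" where
  "scaled_gf n t = tilted_gf n t * Z t ^ n"

text \<open>The exponential growth rate of the moment generating function, normalised to vanish at
  0. The principal logarithm is analytic along \<open>Z\<close> because Re (Z t) > 0 on the
  disc.\<close>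

definition cumulant :: "complex \<Rightarrow> complex" where
  "cumulant t = Ln (Z 0) - Ln (Z t)"

lemma q_pos: "q > 0" using q by simp

lemma W_square: "1 - (W t)\<^sup>2 = exp (- t) / of_real q"
  by (simp add: tilt_root_def)

lemma W_nz:
  assumes "norm t \<le> \<rho>"
  shows "W t \<noteq> 0" "W t \<noteq> 1" "Z t \<noteq> 0" "1 - W t \<noteq> 0"
  using root_bounds(1)[OF assms] pole_bounds(2)[OF assms] \<delta> by (auto simp: tilt_pole_def)

lemma scaled_gf_approx:
  assumes "norm t \<le> \<rho>"
  shows "norm (scaled_gf n t - drift (W t)) \<le> 40 / \<delta> * \<theta> ^ n"
proof -
  have "norm (tilted_gf n t * (W t * (1 - W t)) ^ n - (2 * W t - 1) * (1 + W t) / (2 * (W t)\<^sup>2))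
          \<le> 40 / \<delta> * (4 * norm (W t * (1 - W t))) ^ n"
    unfolding tilted_gf_def
  proof (rule watermelon_gf_pole[OF \<delta>])
    show "Re (W t) \<ge> 0" unfolding tilt_root_def by (rule Re_csqrt)
    show "1 - (W t)\<^sup>2 = 1 / (of_real q * exp t)"
      unfolding W_square by (simp add: exp_minus field_simps)
  qed (use W_nz[OF assms] root_bounds[OF assms] q_pos in auto)
  also have "\<dots> \<le> 40 / \<delta> * \<theta> ^ n"
    using pole_bounds(1)[OF assms] \<delta> unfolding tilt_pole_def
    by (intro mult_left_mono power_mono) auto
  finally show ?thesis by (simp add: scaled_gf_def drift_def tilt_pole_def)
qed

lemma DERIV_W:
  assumes "norm t \<le> \<rho>"
  shows "(W has_field_derivative (1 - (W t)\<^sup>2) / (2 * W t)) (at t)"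
proof -
  have "1 - exp (- t) / of_real q \<notin> \<real>\<^sub>\<le>\<^sub>0"
    using radicand[OF assms] by (auto simp: complex_nonpos_Reals_iff)
  moreover have "((\<lambda>t. 1 - exp (- t) / of_real q) has_field_derivative exp (- t) / of_real q) (at t)"
    using q_pos by (auto intro!: derivative_eq_intros)
  ultimately have "((\<lambda>t. csqrt (1 - exp (- t) / of_real q)) has_field_derivative
                inverse (2 * W t) * (exp (- t) / of_real q)) (at t)"
    unfolding tilt_root_def by (intro DERIV_chain2[OF has_field_derivative_csqrt])
  then show ?thesis
    unfolding W_square by (simp add: tilt_root_def[abs_def] inverse_eq_divide mult.commute)
qed

lemma DERIV_cumulant:
  assumes "norm t \<le> \<rho>"
  shows "(cumulant has_field_derivative drift (W t)) (at t)"
proof -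
  note nz = W_nz[OF assms]
  have "Z t \<notin> \<real>\<^sub>\<le>\<^sub>0"
    using pole_bounds(2)[OF assms] by (auto simp: complex_nonpos_Reals_iff)
  moreover have "(Z has_field_derivative (1 - 2 * W t) * ((1 - (W t)\<^sup>2) / (2 * W t))) (at t)"
  proof -
    have "((\<lambda>t. W t * (1 - W t)) has_field_derivative (1 - 2 * W t) * D) (at t)"
      if "(W has_field_derivative D) (at t)" for D
      using that by (auto intro!: derivative_eq_intros simp: algebra_simps)
    from this[OF DERIV_W[OF assms]] show ?thesis
      by (simp add: tilt_pole_def[abs_def])
  qed
  ultimately have "(cumulant has_field_derivative - ((1 - 2 * W t) * ((1 - (W t)\<^sup>2) / (2 * W t)) / Z t)) (at t)"
    unfolding cumulant_def[abs_def] by (auto intro!: derivative_eq_intros simp: inverse_eq_divide)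
  also have "- ((1 - 2 * W t) * ((1 - (W t)\<^sup>2) / (2 * W t)) / Z t) = drift (W t)"
  proof -
    have "1 - (W t)\<^sup>2 = (1 - W t) * (1 + W t)" by (simp add: power2_eq_square algebra_simps)
    moreover have "- ((1 - 2 * a) * (b / c) / d) = (2 * a - 1) * b / (c * d)" for a b c d :: complex
    proof -
      have "- ((1 - 2 * a) * (b / c) / d) = (- (1 - 2 * a)) * (b / c) / d"
        by (simp only: minus_mult_left minus_divide_left)
      then show ?thesis by simp
    qed
    ultimately show ?thesis
      using nz by (simp add: drift_def tilt_pole_def power2_eq_square)
  qed
  finally show ?thesis .
qed

text \<open>Not the derivative of \<open>drift\<close> in w, but that of \<open>drift (W t)\<close>
  in t, written in terms of w = W t: the chain rule contributes W' = (1 - w^2) / (2 w).\<close>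

definition drift' :: "complex \<Rightarrow> complex" where
  "drift' w = (2 - w) * (1 - w\<^sup>2) / (4 * w ^ 4)"

lemma DERIV_drift_W:
  assumes "norm t \<le> \<rho>"
  shows "((\<lambda>t. drift (W t)) has_field_derivative drift' (W t)) (at t)"
proof -
  have D: "(drift has_field_derivative (2 - w) / (2 * w ^ 3)) (at w)" if "w \<noteq> 0" for w
  proof -
    have "(drift has_field_derivative
            (((2 * (1 + w) + (2 * w - 1)) * (2 * w\<^sup>2) - (2 * w - 1) * (1 + w) * (4 * w)) / ((2 * w\<^sup>2) * (2 * w\<^sup>2)))) (at w)"
      unfolding drift_def[abs_def] using that
      by (auto intro!: derivative_eq_intros simp: algebra_simps)
    also have "(2 * (1 + w) + (2 * w - 1)) * (2 * w\<^sup>2) - (2 * w - 1) * (1 + w) * (4 * w) = 2 * w * (2 - w)"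
      by (simp add: power2_eq_square algebra_simps)
    also have "2 * w * (2 - w) / ((2 * w\<^sup>2) * (2 * w\<^sup>2)) = (2 - w) / (2 * w ^ 3)"
      using that by (simp add: power2_eq_square power3_eq_cube field_simps)
    finally show ?thesis .
  qed
  have "((\<lambda>t. drift (W t)) has_field_derivative
          (2 - W t) / (2 * W t ^ 3) * ((1 - (W t)\<^sup>2) / (2 * W t))) (at t)"
    by (rule DERIV_chain2[OF D DERIV_W]) (use W_nz assms in auto)
  also have "(2 - W t) / (2 * W t ^ 3) * ((1 - (W t)\<^sup>2) / (2 * W t)) = drift' (W t)"
    by (simp add: drift'_def power3_eq_cube power4_eq_xxxx mult_ac)
  finally show ?thesis .
qed

lemma holo: "W holomorphic_on ball 0 \<rho>" "Z holomorphic_on ball 0 \<rho>" "scaled_gf n holomorphic_on ball 0 \<rho>"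
  "(\<lambda>t. drift (W t)) holomorphic_on ball 0 \<rho>"
  "(\<lambda>t. drift' (W t)) holomorphic_on ball 0 \<rho>"
proof -
  show W: "W holomorphic_on ball 0 \<rho>"
    unfolding holomorphic_on_open[OF open_ball] using DERIV_W by force
  then show Z: "Z holomorphic_on ball 0 \<rho>"
    unfolding tilt_pole_def[abs_def] by (intro holomorphic_intros)
  show "scaled_gf n holomorphic_on ball 0 \<rho>"
    unfolding scaled_gf_def[abs_def] tilted_gf_def by (intro holomorphic_intros Z)
  show "(\<lambda>t. drift (W t)) holomorphic_on ball 0 \<rho>"
    unfolding drift_def using W_nz(1) by (intro holomorphic_intros W) auto
  show "(\<lambda>t. drift' (W t)) holomorphic_on ball 0 \<rho>"
    unfolding drift'_def using W_nz(1) by (intro holomorphic_intros W) auto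
qed

lemma theta_power_tendsto: "(\<lambda>n. c * \<theta> ^ n) \<longlonglongrightarrow> 0"
  using \<theta> by (intro tendsto_mult_right_zero LIMSEQ_power_zero) auto

lemma scaled_gf_tendsto: "norm t \<le> \<rho> \<Longrightarrow> (\<lambda>n. scaled_gf n t) \<longlonglongrightarrow> drift (W t)"
  by (rule LIM_zero_cancel, rule Lim_null_comparison[OF _ theta_power_tendsto[of "40 / \<delta>"]])
     (intro always_eventually allI scaled_gf_approx)

text \<open>The approximation is uniform on a complex disc, so Cauchy's inequality on a smaller
  circle transfers the exponential rate to all derivatives at 0.\<close>

lemma higher_deriv_scaled_gf_tendsto:
  "(\<lambda>n. (deriv ^^ j) (scaled_gf n) 0) \<longlonglongrightarrow> (deriv ^^ j) (\<lambda>t. drift (W t)) 0"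
proof (rule LIM_zero_cancel, rule Lim_null_comparison)
  define r where "r = \<rho> / 2"
  have r: "r > 0" "r < \<rho>" using \<rho> by (auto simp: r_def)
  show "eventually (\<lambda>n. norm ((deriv ^^ j) (scaled_gf n) 0 - (deriv ^^ j) (\<lambda>t. drift (W t)) 0) \<le> (fact j * (40 / \<delta>) / r ^ j) * \<theta> ^ n) sequentially"
  proof (rule always_eventually, rule allI)
    fix n
    have "(deriv ^^ j) (scaled_gf n) 0 - (deriv ^^ j) (\<lambda>t. drift (W t)) 0 = (deriv ^^ j) (\<lambda>t. scaled_gf n t - drift (W t)) 0"
      using \<rho> by (intro higher_deriv_diff[symmetric, OF holo(3,4)]) auto
    also have "norm \<dots> \<le> fact j * (40 / \<delta> * \<theta> ^ n) / r ^ j"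
    proof (rule Cauchy_inequality)
      have h: "(\<lambda>t. scaled_gf n t - drift (W t)) holomorphic_on ball 0 \<rho>"
        by (intro holomorphic_intros holo)
      show "(\<lambda>t. scaled_gf n t - drift (W t)) holomorphic_on ball 0 r"
        by (rule holomorphic_on_subset[OF h]) (use r in auto)
      show "continuous_on (cball 0 r) (\<lambda>t. scaled_gf n t - drift (W t))"
        by (rule continuous_on_subset[OF holomorphic_on_imp_continuous_on[OF h]]) (use r in auto)
      show "norm (scaled_gf n t - drift (W t)) \<le> 40 / \<delta> * \<theta> ^ n" if "norm (0 - t) = r" for t
        using that r by (intro scaled_gf_approx) auto
    qed fact
    finally show "norm ((deriv ^^ j) (scaled_gf n) 0 - (deriv ^^ j) (\<lambda>t. drift (W t)) 0) \<le> (fact j * (40 / \<delta>) / r ^ j) * \<theta> ^ n"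
      by (simp add: mult_ac)
  qed
qed (rule theta_power_tendsto)

definition \<omega> :: real where "\<omega> = sqrt (1 - 1 / q)"

lemma omega: "1/2 < \<omega>" "\<omega> < 1" "W 0 = of_real \<omega>"
  unfolding \<omega>_def using tilt_root_0[OF q] by auto

definition mean_rate :: real where "mean_rate = (2 * \<omega> - 1) * (1 + \<omega>) / (2 * \<omega>\<^sup>2)"
definition variance_rate :: real where "variance_rate = (2 - \<omega>) * (1 - \<omega>\<^sup>2) / (4 * \<omega> ^ 4)"

lemma rates_pos: "mean_rate > 0" "variance_rate > 0"
proof -
  have "\<omega>\<^sup>2 < 1" using omega by (simp add: power_less_one_iff abs_square_less_1)
  then show "mean_rate > 0" "variance_rate > 0"
    using omega(1,2) unfolding mean_rate_def variance_rate_def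
    by (intro divide_pos_pos mult_pos_pos; simp)+
qed

lemma drift_0: "drift (W 0) = of_real mean_rate" "drift' (W 0) = of_real variance_rate"
  by (simp_all add: drift_def drift'_def mean_rate_def variance_rate_def omega(3))

end

section \<open>Mean, variance and characteristic function for q > 4/3\<close>

lemma set_contacts_pmf_subset:
  assumes "q > 0"
  shows "set_pmf (contacts_pmf q n) \<subseteq> {..n}"
proof
  fix k assume "k \<in> set_pmf (contacts_pmf q n)"
  then have "num_watermelons n k \<noteq> 0"
    using assms by (auto simp: set_pmf_iff pmf_contacts)
  then show "k \<in> {..n}"
    using num_watermelons_eq_0[of n k] by (cases "k \<le> n") auto
qed

lemma finite_set_contacts_pmf: "q > 0 \<Longrightarrow> finite (set_pmf (contacts_pmf q n))"
  by (rule finite_subset[OF set_contacts_pmf_subset]) auto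

lemma expectation_contacts:
  fixes f :: "nat \<Rightarrow> 'b :: {banach, second_countable_topology}"
  assumes "q > 0"
  shows "measure_pmf.expectation (contacts_pmf q n) f = (\<Sum>k\<le>n. pmf (contacts_pmf q n) k *\<^sub>R f k)"
  by (rule integral_measure_pmf) (use set_contacts_pmf_subset[OF assms] in auto)

lemma bigthetaI_tendsto_pos:
  fixes f g :: "nat \<Rightarrow> real"
  assumes lim: "(\<lambda>n. f n / g n) \<longlonglongrightarrow> c" and c: "c > 0"
    and pos: "eventually (\<lambda>n. g n > 0) sequentially"
  shows "f \<in> \<Theta>(g)"
proof (rule bigthetaI'[of "c / 2" "2 * c"])
  have "eventually (\<lambda>n. f n / g n > c / 2) sequentially" "eventually (\<lambda>n. f n / g n < 2 * c) sequentially"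
    using c by (intro order_tendstoD[OF lim]; simp)+
  then show "eventually (\<lambda>n. c / 2 * norm (g n) \<le> norm (f n) \<and> norm (f n) \<le> 2 * c * norm (g n)) sequentially"
    using pos
  proof eventually_elim
    case (elim n)
    then have *: "c / 2 * g n < f n" "f n < 2 * c * g n" by (simp_all add: field_simps)
    moreover have "c / 2 * g n > 0" by (rule mult_pos_pos[OF half_gt_zero[OF c] elim(3)])
    ultimately have "f n > 0" by linarith
    with * elim show ?case by simp
  qed
qed (use c in auto)

context supercritical
begin

definition contacts_mgf :: "nat \<Rightarrow> complex \<Rightarrow> complex" where
  "contacts_mgf n t = (\<Sum>k\<le>n. of_real (pmf (contacts_pmf q n) k) * exp t ^ k)"

lemma contacts_mgf_eq_tilted_gf: "contacts_mgf n t = tilted_gf n t / of_real (watermelon_weight q n)"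
  unfolding contacts_mgf_def tilted_gf_def sum_divide_distrib
  by (intro sum.cong) (simp_all add: pmf_contacts[OF q_pos] power_mult_distrib)

lemma tilted_gf_0: "tilted_gf n 0 = of_real (watermelon_weight q n)"
  by (simp add: tilted_gf_def watermelon_weight_def)

lemma weight_pos: "watermelon_weight q n > 0"
  by (rule watermelon_weight_pos[OF q_pos])

lemma scaled_gf_0_nz: "scaled_gf n 0 \<noteq> 0"
  using weight_pos[of n] W_nz(3)[of 0] \<rho> by (simp add: scaled_gf_def tilted_gf_0)

text \<open>What remains of the moment generating function after removing exp (n *
  \<open>cumulant\<close> t); it equals 1 at 0.\<close>

definition normalised_gf :: "nat \<Rightarrow> complex \<Rightarrow> complex" where
  "normalised_gf n t = scaled_gf n t / scaled_gf n 0"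

lemma exp_cumulant:
  assumes "norm t \<le> \<rho>"
  shows "exp (cumulant t) = Z 0 / Z t"
  using W_nz(3)[OF assms] W_nz(3)[of 0] \<rho> by (simp add: cumulant_def exp_diff)

lemma contacts_mgf_eq:
  assumes "norm t \<le> \<rho>"
  shows "contacts_mgf n t = normalised_gf n t * exp (of_nat n * cumulant t)"
proof -
  have "exp (of_nat n * cumulant t) = (Z 0 / Z t) ^ n"
    by (simp add: exp_of_nat_mult exp_cumulant[OF assms])
  then show ?thesis
    using W_nz(3)[OF assms] W_nz(3)[of 0] \<rho> weight_pos[of n]
    by (simp add: contacts_mgf_eq_tilted_gf normalised_gf_def scaled_gf_def tilted_gf_0 power_divide)
qed

lemma DERIV_exp_power_sum:
  fixes t :: complex
  shows "((\<lambda>t. \<Sum>k\<le>n. of_real (pmf (contacts_pmf q n) k * real k ^ j) * exp t ^ k) has_field_derivative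
     (\<Sum>k\<le>n. of_real (pmf (contacts_pmf q n) k * real k ^ Suc j) * exp t ^ k)) (at t)"
proof -
  have *: "((\<lambda>t. exp t ^ k) has_field_derivative of_nat k * exp t ^ k) (at t)" for k and t :: complex
    using DERIV_power[OF DERIV_exp[of t], of k] by (cases k) (simp_all add: mult_ac)
  have "((\<lambda>t. \<Sum>k\<le>n. of_real (pmf (contacts_pmf q n) k * real k ^ j) * exp t ^ k) has_field_derivative
          (\<Sum>k\<le>n. of_real (pmf (contacts_pmf q n) k * real k ^ j) * (of_nat k * exp t ^ k))) (at t)"
    by (intro DERIV_sum DERIV_cmult *)
  then show ?thesis by (simp add: mult_ac)
qed

lemma holo_normalised_gf: "normalised_gf n holomorphic_on ball 0 \<rho>"
  unfolding normalised_gf_def[abs_def] using scaled_gf_0_nz by (intro holomorphic_intros holo) auto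

lemma DERIV_normalised_gf:
  assumes "norm t < \<rho>"
  shows "(normalised_gf n has_field_derivative deriv (normalised_gf n) t) (at t)"
        "(deriv (normalised_gf n) has_field_derivative deriv (deriv (normalised_gf n)) t) (at t)"
  using assms by (auto intro!: holomorphic_derivI[OF _ open_ball] holo_normalised_gf holomorphic_deriv)

text \<open>Exact identities, from differentiating the moment generating function twice at 0 in its
  product form. Since \<open>s1\<close> and \<open>s2\<close> converge, the terms linear in n
  determine both orders of growth.\<close>

lemma moments:
  defines "s1 \<equiv> \<lambda>n. deriv (normalised_gf n) 0" and "s2 \<equiv> \<lambda>n. deriv (deriv (normalised_gf n)) 0"
  shows "of_real (contacts_mean q n) = s1 n + of_nat n * of_real mean_rate" (is ?mean)
    and "of_real (contacts_variance q n) = s2 n + of_nat n * of_real variance_rate - (s1 n)\<^sup>2" (is ?var)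
proof -
  \<comment> \<open>\<open>M j\<close> is the j-th derivative of the moment generating function, and
    its value at 0 is the j-th moment.\<close>
  define M where "M = (\<lambda>j t. \<Sum>k\<le>n. complex_of_real (pmf (contacts_pmf q n) k * real k ^ j) * exp t ^ k)"
  have DM: "(M j has_field_derivative M (Suc j) t) (at t)" for j t
    unfolding M_def by (rule DERIV_exp_power_sum)
  define E where "E = (\<lambda>t. exp (of_nat n * cumulant t))"
  have DE: "(E has_field_derivative of_nat n * drift (W t) * E t) (at t)" if "norm t < \<rho>" for t
    unfolding E_def using that by (auto intro!: derivative_eq_intros DERIV_cumulant)
  have M0: "M 0 t = normalised_gf n t * E t" if "norm t < \<rho>" for t
    using contacts_mgf_eq[of t n] that by (simp add: M_def contacts_mgf_def E_def)
  have M1: "M 1 t = (deriv (normalised_gf n) t + of_nat n * drift (W t) * normalised_gf n t) * E t" if "norm t < \<rho>" for t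
  proof -
    have "((\<lambda>t. normalised_gf n t * E t) has_field_derivative (deriv (normalised_gf n) t + of_nat n * drift (W t) * normalised_gf n t) * E t) (at t)"
      using that by (auto intro!: derivative_eq_intros DE DERIV_normalised_gf simp: algebra_simps)
    then have "(M 0 has_field_derivative (deriv (normalised_gf n) t + of_nat n * drift (W t) * normalised_gf n t) * E t) (at t)"
      by (rule has_field_derivative_transform_within_open[of _ _ _ "ball 0 \<rho>"]) (use that M0 in auto)
    then show ?thesis
      using DM[of 0 t] by (auto dest: DERIV_unique)
  qed
  have "((\<lambda>t. (deriv (normalised_gf n) t + of_nat n * drift (W t) * normalised_gf n t) * E t) has_field_derivative
           (deriv (deriv (normalised_gf n)) 0 + of_nat n * drift' (W 0) * normalised_gf n 0 + of_nat n * drift (W 0) * deriv (normalised_gf n) 0) * E 0 +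
           (deriv (normalised_gf n) 0 + of_nat n * drift (W 0) * normalised_gf n 0) * (of_nat n * drift (W 0) * E 0)) (at 0)"
    using \<rho> by (auto intro!: derivative_eq_intros DE DERIV_normalised_gf DERIV_drift_W simp: algebra_simps)
  then have "(M 1 has_field_derivative
           (deriv (deriv (normalised_gf n)) 0 + of_nat n * drift' (W 0) * normalised_gf n 0 + of_nat n * drift (W 0) * deriv (normalised_gf n) 0) * E 0 +
           (deriv (normalised_gf n) 0 + of_nat n * drift (W 0) * normalised_gf n 0) * (of_nat n * drift (W 0) * E 0)) (at 0)"
    by (rule has_field_derivative_transform_within_open[of _ _ _ "ball 0 \<rho>"]) (use \<rho> M1 in auto)
  then have M2: "M 2 0 = (deriv (deriv (normalised_gf n)) 0 + of_nat n * drift' (W 0) * normalised_gf n 0 + of_nat n * drift (W 0) * deriv (normalised_gf n) 0) * E 0 +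
           (deriv (normalised_gf n) 0 + of_nat n * drift (W 0) * normalised_gf n 0) * (of_nat n * drift (W 0) * E 0)"
    using DM[of 1 0] by (auto dest: DERIV_unique simp: numeral_2_eq_2)
  have S0: "normalised_gf n 0 = 1" "E 0 = 1" using scaled_gf_0_nz by (simp_all add: normalised_gf_def E_def cumulant_def)
  have mean: "of_real (contacts_mean q n) = M 1 0"
    unfolding contacts_mean_def expectation_contacts[OF q_pos] M_def by simp
  show ?mean
    unfolding mean using M1[of 0] \<rho> by (simp add: S0 s1_def drift_0)
  have "contacts_variance q n = (\<Sum>k\<le>n. pmf (contacts_pmf q n) k * real k ^ 2) - (contacts_mean q n)\<^sup>2"
    unfolding contacts_variance_def contacts_mean_def
    by (subst measure_pmf.variance_eq)
       (auto intro!: integrable_measure_pmf_finite finite_set_contacts_pmf[OF q_pos] simp: expectation_contacts[OF q_pos])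
  then have "of_real (contacts_variance q n) = M 2 0 - (M 1 0)\<^sup>2"
    unfolding mean[symmetric] by (simp add: M_def)
  also have "\<dots> = s2 n + of_nat n * of_real variance_rate - (s1 n)\<^sup>2"
    using M1[of 0] \<rho> unfolding M2 by (simp add: S0 s1_def s2_def drift_0 power2_eq_square algebra_simps)
  finally show ?var .
qed

lemma deriv_normalised_gf_convergent:
  "convergent (\<lambda>n. deriv (normalised_gf n) 0)" "convergent (\<lambda>n. deriv (deriv (normalised_gf n)) 0)"
proof -
  have R0: "(\<lambda>n. scaled_gf n 0) \<longlonglongrightarrow> of_real mean_rate"
    using scaled_gf_tendsto[of 0] \<rho> by (simp add: drift_0)
  have "(deriv ^^ j) (normalised_gf n) 0 = (deriv ^^ j) (scaled_gf n) 0 / scaled_gf n 0" for j n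
    unfolding normalised_gf_def[abs_def] divide_inverse[of "scaled_gf n _"] mult.commute[of "scaled_gf n _"]
    using \<rho> by (subst higher_deriv_cmult[OF holo(3)]) (auto simp: inverse_eq_divide)
  moreover have "convergent (\<lambda>n. (deriv ^^ j) (scaled_gf n) 0 / scaled_gf n 0)" for j
    using tendsto_divide[OF higher_deriv_scaled_gf_tendsto[of j] R0] rates_pos by (auto intro: convergentI)
  ultimately have "convergent (\<lambda>n. (deriv ^^ j) (normalised_gf n) 0)" for j by simp
  from this[of 1] this[of 2] show "convergent (\<lambda>n. deriv (normalised_gf n) 0)" "convergent (\<lambda>n. deriv (deriv (normalised_gf n)) 0)"
    by (simp_all add: numeral_2_eq_2)
qed

lemma convergent_over_n: "convergent f \<Longrightarrow> (\<lambda>n. f n / of_nat n) \<longlonglongrightarrow> (0 :: complex)"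
proof -
  assume "convergent f"
  then obtain l where "f \<longlonglongrightarrow> l" by (auto simp: convergent_def)
  from tendsto_mult[OF this lim_inverse_n] show ?thesis by (simp add: divide_inverse)
qed

lemma mean_tendsto: "(\<lambda>n. contacts_mean q n / real n) \<longlonglongrightarrow> mean_rate"
proof -
  have "(\<lambda>n. deriv (normalised_gf n) 0 / of_nat n + of_real mean_rate) \<longlonglongrightarrow> 0 + of_real mean_rate"
    by (intro tendsto_add convergent_over_n deriv_normalised_gf_convergent tendsto_const)
  then have "(\<lambda>n. complex_of_real (contacts_mean q n / real n)) \<longlonglongrightarrow> 0 + of_real mean_rate"
  proof (rule Lim_transform_eventually)
    show "eventually (\<lambda>n. deriv (normalised_gf n) 0 / of_nat n + of_real mean_rate = complex_of_real (contacts_mean q n / real n)) sequentially"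
      using eventually_gt_at_top[of 0]
      by eventually_elim (simp add: moments field_simps)
  qed
  then show ?thesis by (simp add: tendsto_of_real_iff del: of_real_divide)
qed

lemma variance_tendsto: "(\<lambda>n. contacts_variance q n / real n) \<longlonglongrightarrow> variance_rate"
proof -
  have c: "convergent (\<lambda>n. (deriv (normalised_gf n) 0)\<^sup>2)"
    using deriv_normalised_gf_convergent(1) by (auto simp: convergent_def intro: tendsto_power)
  have "(\<lambda>n. deriv (deriv (normalised_gf n)) 0 / of_nat n + of_real variance_rate - (deriv (normalised_gf n) 0)\<^sup>2 / of_nat n) \<longlonglongrightarrow> 0 + of_real variance_rate - 0"
    by (intro tendsto_add tendsto_diff convergent_over_n deriv_normalised_gf_convergent c tendsto_const)
  then have "(\<lambda>n. complex_of_real (contacts_variance q n / real n)) \<longlonglongrightarrow> 0 + of_real variance_rate - 0"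
  proof (rule Lim_transform_eventually)
    show "eventually (\<lambda>n. deriv (deriv (normalised_gf n)) 0 / of_nat n + of_real variance_rate - (deriv (normalised_gf n) 0)\<^sup>2 / of_nat n = complex_of_real (contacts_variance q n / real n)) sequentially"
      using eventually_gt_at_top[of 0]
      by eventually_elim (simp add: moments field_simps)
  qed
  then show ?thesis by (simp add: tendsto_of_real_iff del: of_real_divide)
qed

text \<open>Taylor's formula of order two; the third derivative is bounded on the compact disc of
  radius \<rho> / 2 by continuity.\<close>

lemma cumulant_taylor:
  obtains B where "\<And>t. norm t \<le> \<rho> / 2 \<Longrightarrow>
     norm (cumulant t - of_real mean_rate * t - of_real variance_rate * t\<^sup>2 / 2) \<le> B * norm t ^ 3"
proof -
  define f where "f = (\<lambda>i::nat. if i = 0 then cumulant else if i = 1 then (\<lambda>t. drift (W t)) else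
      if i = 2 then (\<lambda>t. drift' (W t)) else deriv (\<lambda>t. drift' (W t)))"
  have "deriv (\<lambda>t. drift' (W t)) holomorphic_on ball 0 \<rho>"
    by (intro holomorphic_deriv holo) auto
  then have "continuous_on (cball 0 (\<rho> / 2)) (deriv (\<lambda>t. drift' (W t)))"
    by (rule continuous_on_subset[OF holomorphic_on_imp_continuous_on]) (use \<rho> in auto)
  then have "compact (deriv (\<lambda>t. drift' (W t)) ` cball 0 (\<rho> / 2))"
    by (intro compact_continuous_image) auto
  then obtain B where B: "\<And>t. norm t \<le> \<rho> / 2 \<Longrightarrow> norm (deriv (\<lambda>t. drift' (W t)) t) \<le> B"
    using compact_imp_bounded bounded_iff by (metis imageI mem_cball_0)
  show ?thesis
  proof (rule that[of "B / 2"])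
    fix t :: complex assume t: "norm t \<le> \<rho> / 2"
    have "norm (f 0 t - (\<Sum>i\<le>2. f i 0 * (t - 0) ^ i / fact i)) \<le> B * norm (t - 0) ^ Suc 2 / fact 2"
    proof (rule complex_Taylor[of "cball 0 (\<rho> / 2)" 2 f])
      fix i and x :: complex assume x: "x \<in> cball 0 (\<rho> / 2)" and "i \<le> (2::nat)"
      then consider "i = 0" | "i = 1" | "i = 2" by linarith
      then show "(f i has_field_derivative f (Suc i) x) (at x within cball 0 (\<rho> / 2))"
      proof cases
        case 1
        then show ?thesis using x \<rho> DERIV_cumulant[of x]
          by (auto simp: f_def intro: has_field_derivative_at_within)
      next
        case 2
        then show ?thesis using x \<rho> DERIV_drift_W[of x]
          by (auto simp: f_def intro: has_field_derivative_at_within)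
      next
        case 3
        then show ?thesis using x \<rho> holomorphic_derivI[OF holo(5) open_ball, of x]
          by (auto simp: f_def)
      qed
    qed (use t \<rho> B in \<open>auto simp: f_def\<close>)
    moreover have "f 0 t - (\<Sum>i\<le>2. f i 0 * (t - 0) ^ i / fact i) = cumulant t - of_real mean_rate * t - of_real variance_rate * t\<^sup>2 / 2"
      by (simp add: f_def numeral_2_eq_2 drift_0 cumulant_def)
    ultimately show "norm (cumulant t - of_real mean_rate * t - of_real variance_rate * t\<^sup>2 / 2) \<le> B / 2 * norm t ^ 3"
      by (simp add: numeral_3_eq_3 fact_numeral)
  qed
qed

lemma char_contacts:
  "char (distr (contacts_pmf q n) borel (\<lambda>k. (real k - m) / s)) \<tau> =
     contacts_mgf n (\<i> * of_real (\<tau> / s)) * exp (- (\<i> * of_real (\<tau> / s) * of_real m))"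
proof -
  have "char (distr (contacts_pmf q n) borel (\<lambda>k. (real k - m) / s)) \<tau> =
          measure_pmf.expectation (contacts_pmf q n) (\<lambda>k. iexp (\<tau> * ((real k - m) / s)))"
    unfolding char_def by (subst integral_distr) auto
  also have "\<dots> = (\<Sum>k\<le>n. of_real (pmf (contacts_pmf q n) k) * iexp (\<tau> * ((real k - m) / s)))"
    by (subst expectation_contacts[OF q_pos]) (simp add: scaleR_conv_of_real)
  also have "\<dots> = (\<Sum>k\<le>n. of_real (pmf (contacts_pmf q n) k) * exp (\<i> * of_real (\<tau> / s)) ^ k * exp (- (\<i> * of_real (\<tau> / s) * of_real m)))"
  proof (intro sum.cong refl)
    fix k
    have "iexp (\<tau> * ((real k - m) / s)) = exp (of_nat k * (\<i> * of_real (\<tau> / s)) + - (\<i> * of_real (\<tau> / s) * of_real m))"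
      by (simp add: algebra_simps diff_divide_distrib)
    then show "of_real (pmf (contacts_pmf q n) k) * iexp (\<tau> * ((real k - m) / s)) =
       of_real (pmf (contacts_pmf q n) k) * exp (\<i> * of_real (\<tau> / s)) ^ k * exp (- (\<i> * of_real (\<tau> / s) * of_real m))"
      by (simp only: exp_add exp_of_nat_mult mult.assoc)
  qed
  finally show ?thesis by (simp add: contacts_mgf_def sum_distrib_right)
qed

text \<open>The argument moves with n, so pointwise convergence would not suffice; the bound on
  \<open>scaled_gf\<close> is uniform on the disc.\<close>

lemma normalised_gf_tendsto:
  assumes "s \<longlonglongrightarrow> 0"
  shows "(\<lambda>n. normalised_gf n (s n)) \<longlonglongrightarrow> 1"
proof -
  have ev: "eventually (\<lambda>n. norm (s n) \<le> \<rho>) sequentially"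
    using order_tendstoD(2)[OF tendsto_norm[OF assms], of \<rho>] \<rho> by (auto elim: eventually_mono)
  have "isCont (\<lambda>t. drift (W t)) 0"
    using DERIV_drift_W[of 0] \<rho> by (auto intro: DERIV_isCont)
  from isCont_tendsto_compose[OF this assms]
  have lim: "(\<lambda>n. drift (W (s n))) \<longlonglongrightarrow> of_real mean_rate" by (simp add: drift_0)
  have "(\<lambda>n. scaled_gf n (s n) - drift (W (s n))) \<longlonglongrightarrow> 0"
    by (rule Lim_null_comparison[OF _ theta_power_tendsto[of "40 / \<delta>"]])
       (use ev in eventually_elim, rule scaled_gf_approx)
  from tendsto_add[OF this lim] have "(\<lambda>n. scaled_gf n (s n)) \<longlonglongrightarrow> of_real mean_rate" by simp
  moreover have "(\<lambda>n. scaled_gf n 0) \<longlonglongrightarrow> of_real mean_rate"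
    using scaled_gf_tendsto[of 0] \<rho> by (simp add: drift_0)
  ultimately have "(\<lambda>n. scaled_gf n (s n) / scaled_gf n 0) \<longlonglongrightarrow> of_real mean_rate / of_real mean_rate"
    using rates_pos by (intro tendsto_divide) auto
  then show ?thesis using rates_pos by (simp add: normalised_gf_def)
qed

text \<open>With s = i \<tau> / \<sigma> n, the product n s^2 tends to - \<tau>^2 /
  \<open>variance_rate\<close>. The quadratic term of the cumulant therefore yields - \<tau>^2 / 2,
  and the cubic remainder n |s|^3 vanishes.\<close>

lemma char_tendsto:
  "(\<lambda>n. char (distr (contacts_pmf q n) borel (\<lambda>k. (real k - contacts_mean q n) / sqrt (contacts_variance q n))) \<tau>)
     \<longlonglongrightarrow> char std_normal_distribution \<tau>"
proof -
  define \<sigma> where "\<sigma> = (\<lambda>n. sqrt (contacts_variance q n))"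
  define s where "s = (\<lambda>n. \<i> * complex_of_real (\<tau> / \<sigma> n))"
  define s1 where "s1 = (\<lambda>n. deriv (normalised_gf n) 0)"
  obtain B where B: "\<And>t. norm t \<le> \<rho> / 2 \<Longrightarrow>
     norm (cumulant t - of_real mean_rate * t - of_real variance_rate * t\<^sup>2 / 2) \<le> B * norm t ^ 3"
    using cumulant_taylor by blast
  have \<sigma>_lim: "(\<lambda>n. sqrt (real n) / \<sigma> n) \<longlonglongrightarrow> 1 / sqrt variance_rate"
  proof -
    have "(\<lambda>n. 1 / sqrt (contacts_variance q n / real n)) \<longlonglongrightarrow> 1 / sqrt variance_rate"
      using rates_pos by (intro tendsto_intros variance_tendsto) auto
    then show ?thesis by (simp add: \<sigma>_def real_sqrt_divide)
  qed
  have inv_sqrt: "(\<lambda>n. 1 / sqrt (real n)) \<longlonglongrightarrow> 0"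
    by (rule divide_sqrt_tendsto_0)
  have inv_\<sigma>: "(\<lambda>n. 1 / \<sigma> n) \<longlonglongrightarrow> 0"
  proof -
    have "(\<lambda>n. 1 / sqrt (real n) * (sqrt (real n) / \<sigma> n)) \<longlonglongrightarrow> 0 * (1 / sqrt variance_rate)"
      by (intro tendsto_mult inv_sqrt \<sigma>_lim)
    then have "(\<lambda>n. 1 / sqrt (real n) * (sqrt (real n) / \<sigma> n)) \<longlonglongrightarrow> 0" by simp
    then show ?thesis
      by (rule Lim_transform_eventually) (use eventually_gt_at_top[of 0] in eventually_elim, simp)
  qed
  have s_lim: "s \<longlonglongrightarrow> 0"
  proof -
    have "(\<lambda>n. \<i> * complex_of_real (\<tau> * (1 / \<sigma> n))) \<longlonglongrightarrow> \<i> * complex_of_real (\<tau> * 0)"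
      by (intro tendsto_intros tendsto_of_real inv_\<sigma>)
    then show ?thesis by (simp add: s_def)
  qed
  have n_over_var: "(\<lambda>n. real n * (\<tau> / \<sigma> n)\<^sup>2) \<longlonglongrightarrow> \<tau>\<^sup>2 / variance_rate"
  proof -
    have "(\<lambda>n. \<tau>\<^sup>2 * (sqrt (real n) / \<sigma> n)\<^sup>2) \<longlonglongrightarrow> \<tau>\<^sup>2 * (1 / sqrt variance_rate)\<^sup>2"
      by (intro tendsto_intros \<sigma>_lim)
    then show ?thesis using rates_pos by (simp add: power_divide mult.commute)
  qed
  have s_sq: "of_nat n * (s n)\<^sup>2 = - complex_of_real (real n * (\<tau> / \<sigma> n)\<^sup>2)" for n
    by (simp add: s_def power_mult_distrib power_divide)
  have ns2: "(\<lambda>n. of_nat n * (s n)\<^sup>2) \<longlonglongrightarrow> - of_real (\<tau>\<^sup>2 / variance_rate)"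
    unfolding s_sq by (intro tendsto_minus tendsto_of_real n_over_var)
  define r where "r = (\<lambda>n. cumulant (s n) - of_real mean_rate * s n - of_real variance_rate * (s n)\<^sup>2 / 2)"
  have ev: "eventually (\<lambda>n. norm (s n) \<le> \<rho> / 2) sequentially"
    using order_tendstoD(2)[OF tendsto_norm[OF s_lim], of "\<rho> / 2"] \<rho> by (auto elim: eventually_mono)
  have r_lim: "(\<lambda>n. of_nat n * r n) \<longlonglongrightarrow> 0"
  proof (rule Lim_null_comparison)
    show "eventually (\<lambda>n. norm (of_nat n * r n) \<le> B * norm (of_nat n * (s n)\<^sup>2) * norm (s n)) sequentially"
      using ev
    proof eventually_elim
      case (elim n)
      have "real n * norm (r n) \<le> real n * (B * norm (s n) ^ 3)"
        unfolding r_def by (intro mult_left_mono B elim) auto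
      then show ?case by (simp add: norm_mult norm_power power3_eq_cube power2_eq_square mult_ac)
    qed
    have "(\<lambda>n. B * norm (of_nat n * (s n)\<^sup>2) * norm (s n)) \<longlonglongrightarrow> B * norm (- complex_of_real (\<tau>\<^sup>2 / variance_rate)) * norm (0 :: complex)"
      by (intro tendsto_intros ns2 s_lim)
    then show "(\<lambda>n. B * norm (of_nat n * (s n)\<^sup>2) * norm (s n)) \<longlonglongrightarrow> 0" by simp
  qed
  obtain l where l: "s1 \<longlonglongrightarrow> l" using deriv_normalised_gf_convergent(1) by (auto simp: convergent_def s1_def)
  have "(\<lambda>n. normalised_gf n (s n) * exp (of_nat n * r n + of_real variance_rate * (of_nat n * (s n)\<^sup>2) / 2 - s n * s1 n)) \<longlonglongrightarrow>
          1 * exp (0 + of_real variance_rate * (- of_real (\<tau>\<^sup>2 / variance_rate)) / 2 - 0 * l)"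
    by (intro tendsto_intros r_lim ns2 s_lim l normalised_gf_tendsto) auto
  also have "1 * exp (0 + of_real variance_rate * (- of_real (\<tau>\<^sup>2 / variance_rate)) / 2 - 0 * l) =
               char std_normal_distribution \<tau>"
  proof -
    have "0 + of_real variance_rate * (- of_real (\<tau>\<^sup>2 / variance_rate)) / 2 - 0 * l = complex_of_real (- \<tau>\<^sup>2 / 2)"
      using rates_pos by simp
    then show ?thesis by (simp only: char_std_normal_distribution exp_of_real mult_1_left)
  qed
  finally show ?thesis
  proof (rule Lim_transform_eventually)
    show "eventually (\<lambda>n. normalised_gf n (s n) * exp (of_nat n * r n + of_real variance_rate * (of_nat n * (s n)\<^sup>2) / 2 - s n * s1 n) =
       char (distr (contacts_pmf q n) borel (\<lambda>k. (real k - contacts_mean q n) / sqrt (contacts_variance q n))) \<tau>) sequentially"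
      using ev
    proof eventually_elim
      case (elim n)
      have "char (distr (contacts_pmf q n) borel (\<lambda>k. (real k - contacts_mean q n) / sqrt (contacts_variance q n))) \<tau> =
              contacts_mgf n (s n) * exp (- (s n * of_real (contacts_mean q n)))"
        unfolding char_contacts s_def \<sigma>_def ..
      also have "contacts_mgf n (s n) = normalised_gf n (s n) * exp (of_nat n * cumulant (s n))"
        using elim \<rho> by (intro contacts_mgf_eq) auto
      also have "normalised_gf n (s n) * exp (of_nat n * cumulant (s n)) * exp (- (s n * of_real (contacts_mean q n))) =
                   normalised_gf n (s n) * exp (of_nat n * cumulant (s n) + - (s n * of_real (contacts_mean q n)))"
        by (simp only: exp_add mult.assoc)
      \<comment> \<open>Centring at the exact mean n * \<open>mean_rate\<close> +
        \<open>s1 n\<close> cancels the linear Taylor term; the leftover \<open>s n * s1 n\<close>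
        tends to 0 because \<open>s1\<close> converges.\<close>
      also have "of_nat n * cumulant (s n) + - (s n * of_real (contacts_mean q n)) =
                   of_nat n * r n + of_real variance_rate * (of_nat n * (s n)\<^sup>2) / 2 - s n * s1 n"
        unfolding moments s1_def r_def by (simp add: algebra_simps)
      finally show ?case by simp
    qed
  qed
qed

theorem supercritical_weak_conv:
  "weak_conv_m (\<lambda>n. distr (contacts_pmf q n) borel (\<lambda>k. (real k - contacts_mean q n) / sqrt (contacts_variance q n)))
               std_normal_distribution"
proof (rule levy_continuity)
  show "real_distribution (distr (contacts_pmf q n) borel (\<lambda>k. (real k - contacts_mean q n) / sqrt (contacts_variance q n)))" for n
    by (rule prob_space.real_distribution_distr[OF prob_space_measure_pmf]) simp
qed (auto intro: real_dist_normal_dist char_tendsto)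

lemma mean_bigtheta: "contacts_mean q \<in> \<Theta>(\<lambda>n. real n)"
  by (rule bigthetaI_tendsto_pos[OF mean_tendsto rates_pos(1)])
     (use eventually_gt_at_top[of 0] in eventually_elim, simp)

lemma variance_bigtheta: "contacts_variance q \<in> \<Theta>(\<lambda>n. real n)"
  by (rule bigthetaI_tendsto_pos[OF variance_tendsto rates_pos(2)])
     (use eventually_gt_at_top[of 0] in eventually_elim, simp)

end

theorem theorem13:
  fixes q :: real
  assumes "q > 0"
  shows "(q < 4/3 \<longrightarrow>
            weak_conv_m (\<lambda>n. distr (contacts_pmf q n) borel (\<lambda>k. real k - 1))
                        (distr (neg_binomial_pmf 2 (1 - 3/4 * q)) borel real)) \<and>
         (q = 4/3 \<longrightarrow>
            weak_conv_m (\<lambda>n. distr (contacts_pmf q n) borel (\<lambda>k. 2/3 * (real k / sqrt (real n))))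
                        (rayleigh_distribution (sqrt 2))) \<and>
         (q > 4/3 \<longrightarrow>
            weak_conv_m (\<lambda>n. distr (contacts_pmf q n) borel
                               (\<lambda>k. (real k - contacts_mean q n) / sqrt (contacts_variance q n)))
                        std_normal_distribution \<and>
            contacts_mean q \<in> \<Theta>(\<lambda>n. real n) \<and>
            contacts_variance q \<in> \<Theta>(\<lambda>n. real n))"
proof (intro conjI impI)
  assume "q < 4/3"
  with assms show "weak_conv_m (\<lambda>n. distr (contacts_pmf q n) borel (\<lambda>k. real k - 1))
                        (distr (neg_binomial_pmf 2 (1 - 3/4 * q)) borel real)"
    by (rule subcritical_weak_conv)
next
  assume "q = 4/3"
  then show "weak_conv_m (\<lambda>n. distr (contacts_pmf q n) borel (\<lambda>k. 2/3 * (real k / sqrt (real n))))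
                        (rayleigh_distribution (sqrt 2))"
    using critical_weak_conv by (simp only:)
next
  assume "q > 4/3"
  then obtain \<rho> \<delta> \<theta> where "supercritical q \<rho> \<delta> \<theta>"
    using supercritical_exists by blast
  then interpret supercritical q \<rho> \<delta> \<theta> .
  show "weak_conv_m (\<lambda>n. distr (contacts_pmf q n) borel
           (\<lambda>k. (real k - contacts_mean q n) / sqrt (contacts_variance q n))) std_normal_distribution"
    by (rule supercritical_weak_conv)
  show "contacts_mean q \<in> \<Theta>(\<lambda>n. real n)" by (rule mean_bigtheta)
  show "contacts_variance q \<in> \<Theta>(\<lambda>n. real n)" by (rule variance_bigtheta)
qed

end
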